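(* Let $\alpha,\beta>0$ and $[0,T]\subset[0,1]$, $T>0$. Then $T_x:H_\beta([0,T])\to H_\beta([0,T])$ for every $x\in H_\alpha([0,T])$ if and only if $\alpha\ge\beta$ and, for every $x\in H_\alpha([0,T])$, there is a constant $C$ such that $$\sum_{k=k_0+1}^{\infty}2^{k(1-\beta)}|B_{k-1}(x;a,b)|\le C\,2^{-\beta k_0}$$ for all $0\le a<b\le T$ and integers $k_0>1$ with $2^{-k_0-1}\le b-a\le2^{-k_0+1}$ (so $C$ does not depend on $k_0$).
   Context: For $0<\beta\le1$, $H_\beta([0,T])$ is the class of functions on $[0,T]$ with finite seminorm $\sup_{s\ne t}|f(s)-f(t)|/|s-t|^\beta$ (Hölder exponents always lie in $(0,1]$). For a continuous $x$ on $[0,T]$ put $t_{k,n}=n2^{-k}$ and $h_{k,n}=h_{k,n}(x)=2^k\int_{t_{k,n}}^{t_{k,n+1}}x(\tau)\,d\tau$ whenever $[t_{k,n},t_{k,n+1}]\subset[0,T]$. For $0\le a<b\le T$ and $k\ge1$ let $n_k(a)$ and $n_k(b)$ be the smallest and the largest element of the set of consecutive integers $\{n:\ 0\le n\le 2^k,\ [t_{k-1,\lfloor n/2\rfloor},t_{k-1,\lfloor n/2\rfloor+1}]\subset[a,b]\}$ (if this set is empty, the sum below is $0$). By definition, $$\int_a^b y(u)\,dx(u)=\lim_{k\to\infty}\sum_{n=n_k(a)+1}^{n_k(b)}y(t_{k,n})\,(h_{k,n}-h_{k,n-1}),$$ and the integral exists if this limit exists (finite). The operator $T_x$ is $$(T_xy)(t)=y_0+\int_0^t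 y(u)\,dx(u),\quad t\in[0,T],\ y\in H_\beta([0,T]),$$ with $y_0\in\mathbb{R}$ fixed; "$T_x:H_\beta\to H_\beta$" means that for every $y\in H_\beta([0,T])$ the integrals exist and $T_xy\in H_\beta([0,T])$. $|B_k(x;a,b)|=2^{-(k+1)}\sum_{n:\,[t_{k,n},t_{k,n+1}]\subset[a,b]}|h_{k+1,2n+1}(x)-h_{k+1,2n}(x)|$ is the (unsigned) area, over the dyadic intervals of level $k$ contained in $[a,b]$, between the polygonal step curves with heights $h_{k,n}(x)$ and $h_{k+1,n}(x)$. *)

theory Defs
  imports "HOL-Analysis.Analysis"
begin

text \<open>
  A function on \<open>[0,T]\<close> is represented by a total function on the reals of which
  only the values on \<open>{0..T}\<close> are used.
\<close>

definition holder :: "real \<Rightarrow> real \<Rightarrow> (real \<Rightarrow> real) set" where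
  "holder \<beta> T = {f. bdd_above {\<bar>f s - f t\<bar> / \<bar>s - t\<bar> powr \<beta> | s t.
      s \<in> {0..T} \<and> t \<in> {0..T} \<and> s \<noteq> t}}"

definition dyadic :: "nat \<Rightarrow> nat \<Rightarrow> real" where
  "dyadic k n = real n / 2 ^ k"

definition dyadic_interval :: "nat \<Rightarrow> nat \<Rightarrow> real set" where
  "dyadic_interval k n = {dyadic k n .. dyadic k (n + 1)}"

definition height :: "(real \<Rightarrow> real) \<Rightarrow> nat \<Rightarrow> nat \<Rightarrow> real" where
  "height x k n = 2 ^ k * integral (dyadic_interval k n) x"

text \<open>
  The next two definitions are meaningful for \<open>k \<ge> 1\<close> only: at \<open>k = 0\<close> the
  difference \<open>k - 1\<close> is truncated, which does not affect the limit
  \<open>k \<rightarrow> \<infinity>\<close>.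
\<close>

definition index_set :: "real \<Rightarrow> real \<Rightarrow> nat \<Rightarrow> nat set" where
  "index_set a b k = {n. n \<le> 2 ^ k \<and> dyadic_interval (k - 1) (n div 2) \<subseteq> {a..b}}"

definition approx_sum ::
    "(real \<Rightarrow> real) \<Rightarrow> (real \<Rightarrow> real) \<Rightarrow> real \<Rightarrow> real \<Rightarrow> nat \<Rightarrow> real" where
  "approx_sum x y a b k =
     (if index_set a b k = {} then 0
      else (\<Sum>n = Min (index_set a b k) + 1 .. Max (index_set a b k).
              y (dyadic k n) * (height x k n - height x k (n - 1))))"

definition dyadic_integrable ::
    "(real \<Rightarrow> real) \<Rightarrow> (real \<Rightarrow> real) \<Rightarrow> real \<Rightarrow> real \<Rightarrow> bool" where
  "dyadic_integrable x y a b \<longleftrightarrow> convergent (approx_sum x y a b)"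

text \<open>
  The integral of \<open>y\<close> against \<open>dx\<close> over \<open>[a,b]\<close>.  For \<open>a = b\<close> every index set is
  empty, so that the integral exists and is \<open>0\<close>.
\<close>

definition dyadic_integral ::
    "(real \<Rightarrow> real) \<Rightarrow> (real \<Rightarrow> real) \<Rightarrow> real \<Rightarrow> real \<Rightarrow> real" where
  "dyadic_integral x y a b = lim (approx_sum x y a b)"

definition T_op :: "real \<Rightarrow> (real \<Rightarrow> real) \<Rightarrow> (real \<Rightarrow> real) \<Rightarrow> real \<Rightarrow> real" where
  "T_op y0 x y = (\<lambda>t. y0 + dyadic_integral x y 0 t)"

definition T_op_maps_holder :: "real \<Rightarrow> real \<Rightarrow> real \<Rightarrow> (real \<Rightarrow> real) \<Rightarrow> bool" where
  "T_op_maps_holder \<beta> T y0 x \<longleftrightarrow>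
     (\<forall>y \<in> holder \<beta> T. (\<forall>t \<in> {0..T}. dyadic_integrable x y 0 t) \<and> T_op y0 x y \<in> holder \<beta> T)"

text \<open>
  The index set of the sum is finite, and because of \<open>a \<ge> 0\<close> in all uses, letting \<open>n\<close>
  range over the natural numbers omits no dyadic interval contained in \<open>[a,b]\<close>.
\<close>

definition area :: "(real \<Rightarrow> real) \<Rightarrow> real \<Rightarrow> real \<Rightarrow> nat \<Rightarrow> real" where
  "area x a b k = (1 / 2 ^ (k + 1)) *
     (\<Sum>n | dyadic_interval k n \<subseteq> {a..b}.
        \<bar>height x (k + 1) (2 * n + 1) - height x (k + 1) (2 * n)\<bar>)"

end

theory Submission
  imports Defs
begin

text \<open>
  Both sides of the equivalence hold precisely when \<open>\<beta> \<le> \<alpha>\<close> and \<open>\<alpha> + \<beta> > 1\<close>, the latter being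
  the condition of Young for the existence of the integral.

  Summation by parts turns the sums that define the integral into Riemann sums of \<open>x\<close> against \<open>y\<close>
  (\<open>approx_sum_tendsto\<close>).  Refining the dyadic partition of such a Riemann sum from level \<open>k\<close> to level
  \<open>k + 1\<close> changes it, up to the sign, by the sum over the cells of level \<open>k\<close> of the products of a Haar
  difference of \<open>x\<close> with a midpoint defect of \<open>y\<close> (\<open>riemann_sum_refine\<close>).  These are of order \<open>2\<close> to the powers
  \<open>-k \<alpha>\<close> and \<open>-k \<beta>\<close>, and there are about \<open>2\<^sup>k\<close> cells per unit length.

  If \<open>\<alpha> + \<beta> > 1\<close>, the changes are therefore summable, with sums that are Hoelder continuous in the
  endpoint (\<open>riemann_sum_limit\<close>).  The same bound on the Haar differences gives the estimate of the
  areas (\<open>area_series_bound\<close>).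

  If \<open>\<alpha> + \<beta> \<le> 1\<close>, one pair of lacunary series refutes both sides.  For the Weierstrass series
  \<open>x\<close>, with terms \<open>sin (2\<pi> 2\<^sup>j u)\<close> weighted by \<open>2\<close> to the power \<open>-j \<alpha>\<close>, the sum of the Haar differences
  of level \<open>k\<close> over a period is exactly \<open>-4/\<pi>\<close> times \<open>2\<close> to the power \<open>k (1 - \<alpha>)\<close>
  (\<open>haar_sum_weierstrass\<close>).  For the Takagi series \<open>y\<close>, with terms the distance of \<open>2\<^sup>j u\<close> to the integers
  weighted by \<open>2\<close> to the power \<open>-j \<beta>\<close>, every midpoint defect of level \<open>k\<close> is exactly half of \<open>2\<close> to
  the power \<open>-k \<beta>\<close> (\<open>midpoint_defect_takagi\<close>).  Both follow from the functional equations of the series.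
  As the midpoint defects of a level are all equal, the change of the Riemann sum is the product of these two
  quantities, which does not tend to zero; and the sums of the Haar differences
  alone make the area series of \<open>x\<close> diverge.
  Dilating by \<open>2\<^sup>p\<close> places a full period inside \<open>[0,T]\<close>.

  The inequality \<open>\<beta> \<le> \<alpha>\<close> is necessary for the mapping property, as the constant function \<open>y = 1\<close>
  shows (\<open>exponent_le_of_T_maps\<close>).
\<close>

section \<open>Hoelder functions and dyadic scales\<close>

lemma dyadic_powr: "(1 / 2 ^ k) powr \<gamma> = (2 powr - \<gamma>) ^ k" for \<gamma> :: real
  by (simp add: powr_minus powr_divide powr_realpow[symmetric] powr_powr powr_power
      inverse_eq_divide mult.commute power_divide)

lemma obtain_dyadic_scale:
  fixes \<delta> :: real
  assumes "0 < \<delta>" "\<delta> \<le> 1"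
  obtains K where "\<delta> \<le> 1 / 2 ^ K" "1 / 2 ^ K \<le> 2 * \<delta>"
proof -
  obtain n :: nat where n: "(1/2) ^ n < \<delta>"
    using real_arch_pow_inv[of \<delta> "1/2"] assms by auto
  define K where "K = (GREATEST K. \<delta> \<le> 1 / 2 ^ K)"
  have bound: "K' \<le> n" if "\<delta> \<le> 1 / 2 ^ K'" for K'
  proof (rule ccontr)
    assume "\<not> K' \<le> n"
    then have "(1/2::real) ^ K' \<le> (1/2) ^ n" by (intro power_decreasing) auto
    with that n show False by (simp add: power_divide)
  qed
  have ex: "\<delta> \<le> 1 / 2 ^ (0::nat)" using assms by simp
  have 1: "\<delta> \<le> 1 / 2 ^ K"
    unfolding K_def by (rule GreatestI_nat[where P="\<lambda>K. \<delta> \<le> 1 / 2 ^ K", OF ex]) (use bound in auto)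
  have "\<not> \<delta> \<le> 1 / 2 ^ Suc K"
  proof
    assume "\<delta> \<le> 1 / 2 ^ Suc K"
    then have "Suc K \<le> K"
      unfolding K_def by (rule Greatest_le_nat[where P="\<lambda>K. \<delta> \<le> 1 / 2 ^ K"]) (use bound in auto)
    then show False by simp
  qed
  with 1 that show thesis by (simp add: field_simps)
qed

lemma holderE:
  assumes "f \<in> holder \<gamma> T"
  obtains C where "0 \<le> C"
    "\<And>s t. s \<in> {0..T} \<Longrightarrow> t \<in> {0..T} \<Longrightarrow> \<bar>f s - f t\<bar> \<le> C * \<bar>s - t\<bar> powr \<gamma>"
proof -
  obtain M where M: "\<And>s t. s \<in> {0..T} \<Longrightarrow> t \<in> {0..T} \<Longrightarrow> s \<noteq> t \<Longrightarrow>
      \<bar>f s - f t\<bar> / \<bar>s - t\<bar> powr \<gamma> \<le> M"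
    using assms unfolding holder_def bdd_above_def by blast
  show thesis
  proof (rule that[of "max M 0"])
    fix s t assume st: "s \<in> {0..T}" "t \<in> {0..T}"
    show "\<bar>f s - f t\<bar> \<le> max M 0 * \<bar>s - t\<bar> powr \<gamma>"
    proof (cases "s = t")
      case False
      then have "\<bar>f s - f t\<bar> \<le> M * \<bar>s - t\<bar> powr \<gamma>"
        using M[OF st] by (simp add: divide_le_eq)
      also have "\<dots> \<le> max M 0 * \<bar>s - t\<bar> powr \<gamma>" by (intro mult_right_mono) auto
      finally show ?thesis .
    qed simp
  qed simp
qed

lemma holderI:
  assumes "\<And>s t. 0 \<le> s \<Longrightarrow> s < t \<Longrightarrow> t \<le> T \<Longrightarrow> \<bar>f t - f s\<bar> \<le> C * (t - s) powr \<gamma>"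
  shows "f \<in> holder \<gamma> T"
proof -
  have "\<bar>f s - f t\<bar> / \<bar>s - t\<bar> powr \<gamma> \<le> C" if "s \<in> {0..T}" "t \<in> {0..T}" "s \<noteq> t" for s t
  proof (cases "s < t")
    case True
    then show ?thesis
      using assms[of s t] that by (simp add: divide_le_eq abs_minus_commute)
  next
    case False
    then show ?thesis
      using assms[of t s] that by (simp add: divide_le_eq)
  qed
  then show ?thesis unfolding holder_def bdd_above_def by blast
qed

text \<open>
  It suffices to control the increments over distances \<open>2\<^sup>-\<^sup>K\<close>, because every distance
  agrees with one of these up to a factor of two.
\<close>

lemma holderI_dyadic:
  assumes "0 < \<gamma>" "T \<le> 1" "0 \<le> C"
    and mod: "\<And>s t K. 0 \<le> s \<Longrightarrow> s < t \<Longrightarrow> t \<le> T \<Longrightarrow> t - s \<le> 1 / 2 ^ K \<Longrightarrow>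
      \<bar>f t - f s\<bar> \<le> C * (2 powr - \<gamma>) ^ K"
  shows "f \<in> holder \<gamma> T"
proof (rule holderI)
  fix s t assume st: "0 \<le> s" "s < t" "t \<le> T"
  obtain K where K: "t - s \<le> 1 / 2 ^ K" "1 / 2 ^ K \<le> 2 * (t - s)"
    using obtain_dyadic_scale[of "t - s"] st assms by auto
  have "(2 powr - \<gamma>) ^ K \<le> (2 * (t - s)) powr \<gamma>"
    unfolding dyadic_powr[symmetric] using K assms by (intro powr_mono2) auto
  also have "\<dots> = 2 powr \<gamma> * (t - s) powr \<gamma>" by (rule powr_mult)
  finally have "C * (2 powr - \<gamma>) ^ K \<le> C * (2 powr \<gamma> * (t - s) powr \<gamma>)"
    using \<open>0 \<le> C\<close> by (rule mult_left_mono)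
  with mod[OF st K(1)] show "\<bar>f t - f s\<bar> \<le> C * 2 powr \<gamma> * (t - s) powr \<gamma>" by simp
qed

lemma holder_cong:
  assumes "\<And>t. t \<in> {0..T} \<Longrightarrow> f t = g t"
  shows "f \<in> holder \<gamma> T \<longleftrightarrow> g \<in> holder \<gamma> T"
  using assms unfolding holder_def by (auto simp: bdd_above_def) metis+

lemma holder_const: "(\<lambda>_. c) \<in> holder \<gamma> T"
  by (rule holderI[where C=0]) auto

lemma holder_diff:
  assumes "f \<in> holder \<gamma> T" "g \<in> holder \<gamma> T"
  shows "(\<lambda>t. f t - g t) \<in> holder \<gamma> T"
proof -
  obtain C where C: "\<And>s t. s \<in> {0..T} \<Longrightarrow> t \<in> {0..T} \<Longrightarrow> \<bar>f s - f t\<bar> \<le> C * \<bar>s - t\<bar> powr \<gamma>"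
    using holderE[OF assms(1)] by metis
  obtain D where D: "\<And>s t. s \<in> {0..T} \<Longrightarrow> t \<in> {0..T} \<Longrightarrow> \<bar>g s - g t\<bar> \<le> D * \<bar>s - t\<bar> powr \<gamma>"
    using holderE[OF assms(2)] by metis
  show ?thesis
  proof (rule holderI)
    fix s t assume "0 \<le> s" "s < t" "t \<le> T"
    then show "\<bar>f t - g t - (f s - g s)\<bar> \<le> (C + D) * (t - s) powr \<gamma>"
      using C[of t s] D[of t s] by (simp add: distrib_right)
  qed
qed

lemma holder_continuous_on:
  assumes "f \<in> holder \<gamma> T" "0 < \<gamma>"
  shows "continuous_on {0..T} f"
proof -
  obtain C where C: "0 \<le> C"
    "\<And>s t. s \<in> {0..T} \<Longrightarrow> t \<in> {0..T} \<Longrightarrow> \<bar>f s - f t\<bar> \<le> C * \<bar>s - t\<bar> powr \<gamma>"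
    using holderE[OF assms(1)] by metis
  show ?thesis
    unfolding continuous_on
  proof
    fix t assume t: "t \<in> {0..T}"
    have "((\<lambda>s. C * \<bar>s - t\<bar> powr \<gamma>) \<longlongrightarrow> C * \<bar>t - t\<bar> powr \<gamma>) (at t within {0..T})"
      using \<open>0 < \<gamma>\<close>
      by (intro tendsto_intros tendsto_powr2) (auto intro!: always_eventually)
    then have "((\<lambda>s. C * \<bar>s - t\<bar> powr \<gamma>) \<longlongrightarrow> 0) (at t within {0..T})" by simp
    then have "((\<lambda>s. f s - f t) \<longlongrightarrow> 0) (at t within {0..T})"
      by (rule Lim_null_comparison[rotated])
        (use C(2) t in \<open>auto simp: eventually_at_filter intro!: always_eventually\<close>)
    then show "(f \<longlongrightarrow> f t) (at t within {0..T})" by (simp add: LIM_zero_iff)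
  qed
qed

lemma holder_bounded:
  assumes "f \<in> holder \<gamma> T" "0 < \<gamma>"
  obtains B where "0 \<le> B" "\<And>t. t \<in> {0..T} \<Longrightarrow> \<bar>f t\<bar> \<le> B"
proof -
  have "bounded (f ` {0..T})"
    by (intro compact_imp_bounded compact_continuous_image holder_continuous_on[OF assms]) auto
  then obtain B where "\<And>t. t \<in> {0..T} \<Longrightarrow> \<bar>f t\<bar> \<le> B"
    unfolding bounded_iff by (metis imageI real_norm_def)
  then show thesis using that[of "max B 0"] by fastforce
qed

lemma holder_mono:
  assumes "f \<in> holder \<alpha> T" "\<beta> \<le> \<alpha>" "0 < \<beta>" "T \<le> 1"
  shows "f \<in> holder \<beta> T"
proof -
  obtain C where C: "0 \<le> C"
    "\<And>s t. s \<in> {0..T} \<Longrightarrow> t \<in> {0..T} \<Longrightarrow> \<bar>f s - f t\<bar> \<le> C * \<bar>s - t\<bar> powr \<alpha>"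
    using holderE[OF assms(1)] by metis
  show ?thesis
  proof (rule holderI)
    fix s t assume st: "0 \<le> s" "s < t" "t \<le> T"
    have "(t - s) powr \<alpha> \<le> (t - s) powr \<beta>"
      using st assms by (intro powr_mono') auto
    then have "C * (t - s) powr \<alpha> \<le> C * (t - s) powr \<beta>" using C(1) by (rule mult_left_mono)
    with C(2)[of t s] st show "\<bar>f t - f s\<bar> \<le> C * (t - s) powr \<beta>" by simp
  qed
qed

lemma holder_mult:
  assumes f: "f \<in> holder \<gamma> T" and g: "g \<in> holder \<gamma> T" and "0 < \<gamma>"
  shows "(\<lambda>t. f t * g t) \<in> holder \<gamma> T"
proof -
  obtain C where C: "\<And>s t. s \<in> {0..T} \<Longrightarrow> t \<in> {0..T} \<Longrightarrow> \<bar>f s - f t\<bar> \<le> C * \<bar>s - t\<bar> powr \<gamma>"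
    using holderE[OF f] by metis
  obtain D where D: "\<And>s t. s \<in> {0..T} \<Longrightarrow> t \<in> {0..T} \<Longrightarrow> \<bar>g s - g t\<bar> \<le> D * \<bar>s - t\<bar> powr \<gamma>"
    using holderE[OF g] by metis
  obtain F where F: "0 \<le> F" "\<And>t. t \<in> {0..T} \<Longrightarrow> \<bar>f t\<bar> \<le> F"
    using holder_bounded[OF f \<open>0 < \<gamma>\<close>] by metis
  obtain G where G: "0 \<le> G" "\<And>t. t \<in> {0..T} \<Longrightarrow> \<bar>g t\<bar> \<le> G"
    using holder_bounded[OF g \<open>0 < \<gamma>\<close>] by metis
  show ?thesis
  proof (rule holderI)
    fix s t assume st: "0 \<le> s" "s < t" "t \<le> T"
    have "\<bar>f t * g t - f s * g s\<bar> = \<bar>f t * (g t - g s) + (f t - f s) * g s\<bar>"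
      by (simp add: algebra_simps)
    also have "\<dots> \<le> \<bar>f t\<bar> * \<bar>g t - g s\<bar> + \<bar>f t - f s\<bar> * \<bar>g s\<bar>"
      by (metis abs_mult abs_triangle_ineq)
    also have "\<dots> \<le> F * (D * (t - s) powr \<gamma>) + (C * (t - s) powr \<gamma>) * G"
      using st F G C[of t s] D[of t s] by (intro add_mono mult_mono) auto
    finally show "\<bar>f t * g t - f s * g s\<bar> \<le> (F * D + C * G) * (t - s) powr \<gamma>"
      by (simp add: algebra_simps)
  qed
qed

lemma holder_powr:
  assumes "0 < \<alpha>" "\<alpha> \<le> 1"
  shows "(\<lambda>t. t powr \<alpha>) \<in> holder \<alpha> T"
proof (rule holderI)
  fix s t :: real assume st: "0 \<le> s" "s < t" "t \<le> T"
  \<comment> \<open>After division by \<open>t\<close> the claim follows from \<open>1 = u + (1 - u)\<close>, as raising a number in the unit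
    interval to the power \<open>\<alpha>\<close> does not decrease it.\<close>
  define u where "u = s / t"
  have u: "0 \<le> u" "u \<le> 1" using st by (auto simp: u_def)
  have "v \<le> v powr \<alpha>" if "0 \<le> v" "v \<le> 1" for v :: real
    using powr_mono'[of \<alpha> 1 v] that assms by (cases "v = 0") auto
  from this[of u] this[of "1 - u"] u have "1 \<le> u powr \<alpha> + (1 - u) powr \<alpha>" by simp
  then have "t powr \<alpha> * 1 \<le> t powr \<alpha> * (u powr \<alpha> + (1 - u) powr \<alpha>)"
    by (intro mult_left_mono) auto
  also have "\<dots> = (t * u) powr \<alpha> + (t * (1 - u)) powr \<alpha>"
    using st u by (simp add: powr_mult distrib_left)
  also have "t * u = s" using st by (simp add: u_def)
  also have "t * (1 - u) = t - s" using st by (simp add: u_def field_simps)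
  finally have "t powr \<alpha> - s powr \<alpha> \<le> (t - s) powr \<alpha>" by simp
  moreover have "s powr \<alpha> \<le> t powr \<alpha>" using st assms by (intro powr_mono2) auto
  ultimately show "\<bar>t powr \<alpha> - s powr \<alpha>\<bar> \<le> 1 * (t - s) powr \<alpha>" by simp
qed

section \<open>Dyadic averages\<close>

lemma dyadic_nonneg [simp]: "0 \<le> dyadic k n"
  by (simp add: dyadic_def)

lemma dyadic_zero [simp]: "dyadic k 0 = 0"
  by (simp add: dyadic_def)

lemma dyadic_double: "dyadic (Suc k) (2 * n) = dyadic k n"
  by (simp add: dyadic_def)

lemma dyadic_mono: "m \<le> n \<Longrightarrow> dyadic k m \<le> dyadic k n"
  by (simp add: dyadic_def divide_right_mono)

lemma dyadic_Suc: "dyadic k (Suc n) = dyadic k n + 1 / 2 ^ k"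
  by (simp add: dyadic_def add_divide_distrib)

text \<open>
  Parametrising each dyadic interval by the unit interval turns translations and dilations of
  the function into shifts of the level and of the index, with no change of variables left.
\<close>

lemma height_eq_unit_integral: "height x k n = integral {0..1} (\<lambda>v. x ((real n + v) / 2 ^ k))"
proof -
  define m :: real where "m = 1 / 2 ^ k"
  have m: "m > 0" by (simp add: m_def)
  have iff: "((\<lambda>v. x ((real n + v) / 2 ^ k)) has_integral (I / m)) {0..1}
      \<longleftrightarrow> (x has_integral I) (dyadic_interval k n)" for I
  proof -
    have eq: "(real n + v) / 2 ^ k = m *\<^sub>R v + dyadic k n" for v
      by (simp add: m_def dyadic_def field_simps)
    have box: "cbox ((dyadic k n - dyadic k n) /\<^sub>R m) ((dyadic k (n + 1) - dyadic k n) /\<^sub>R m) = {0..1}"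
      using m by (simp add: dyadic_Suc) (simp add: m_def)
    show ?thesis
      using has_integral_affinity_iff[OF m, of x "dyadic k n" I "dyadic k n" "dyadic k (n + 1)"]
      unfolding box dyadic_interval_def eq by (simp add: divide_inverse mult.commute)
  qed
  show ?thesis
  proof (cases "x integrable_on dyadic_interval k n")
    case True
    then have "((\<lambda>v. x ((real n + v) / 2 ^ k)) has_integral
        (integral (dyadic_interval k n) x / m)) {0..1}"
      unfolding iff by (rule integrable_integral)
    then show ?thesis
      by (simp add: height_def m_def integral_unique mult.commute)
  next
    case False
    have "\<not> (\<lambda>v. x ((real n + v) / 2 ^ k)) integrable_on {0..1}"
    proof
      assume "(\<lambda>v. x ((real n + v) / 2 ^ k)) integrable_on {0..1}"
      then obtain J where "((\<lambda>v. x ((real n + v) / 2 ^ k)) has_integral J) {0..1}" by blast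
      with iff[of "J * m"] m False show False by auto
    qed
    with False show ?thesis by (simp add: height_def not_integrable_integral)
  qed
qed

lemma height_near:
  assumes cont: "continuous_on (dyadic_interval k n) x"
    and near: "\<And>u. u \<in> dyadic_interval k n \<Longrightarrow> \<bar>x u - c\<bar> \<le> e"
  shows "\<bar>height x k n - c\<bar> \<le> e"
proof -
  have mem: "(real n + v) / 2 ^ k \<in> dyadic_interval k n" if "v \<in> {0..1}" for v
    using that by (auto simp: dyadic_interval_def dyadic_def divide_right_mono)
  have cont': "continuous_on {0..1} (\<lambda>v. x ((real n + v) / 2 ^ k))"
    by (rule continuous_on_compose2[OF cont]) (use mem in \<open>auto intro!: continuous_intros\<close>)
  have "height x k n - c = integral {0..1} (\<lambda>v. x ((real n + v) / 2 ^ k) - c)"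
    unfolding height_eq_unit_integral
    by (subst integral_diff) (auto intro!: integrable_continuous_real cont')
  also have "norm \<dots> \<le> e * (1 - 0)"
    by (rule integral_bound) (use near mem in \<open>auto intro!: continuous_intros cont'\<close>)
  finally show ?thesis by simp
qed

lemma height_average:
  assumes "continuous_on (dyadic_interval k m) x"
  shows "height x k m = (height x (Suc k) (2 * m) + height x (Suc k) (2 * m + 1)) / 2"
proof -
  have right: "dyadic (Suc k) (Suc (Suc (2 * m))) = dyadic k (Suc m)"
    using dyadic_double[of k "Suc m"] by simp
  have "dyadic k m \<le> dyadic (Suc k) (Suc (2 * m))"
    "dyadic (Suc k) (Suc (2 * m)) \<le> dyadic k (Suc m)"
    by (auto simp: dyadic_def field_simps)
  then have "integral {dyadic k m..dyadic (Suc k) (Suc (2 * m))} x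
      + integral {dyadic (Suc k) (Suc (2 * m))..dyadic k (Suc m)} x
      = integral {dyadic k m..dyadic k (Suc m)} x"
    using assms
    by (intro Henstock_Kurzweil_Integration.integral_combine integrable_continuous_real)
      (auto simp: dyadic_interval_def)
  then have "integral (dyadic_interval k m) x = integral (dyadic_interval (Suc k) (2 * m)) x
      + integral (dyadic_interval (Suc k) (2 * m + 1)) x"
    by (simp add: dyadic_interval_def dyadic_double right)
  then show ?thesis by (simp add: height_def algebra_simps)
qed

text \<open>
  Up to normalisation these are the Haar coefficients of \<open>x\<close>; the areas in the theorem are their
  absolute sums.
\<close>

definition haar_diff :: "(real \<Rightarrow> real) \<Rightarrow> nat \<Rightarrow> nat \<Rightarrow> real" where
  "haar_diff x k m = height x (k + 1) (2 * m + 1) - height x (k + 1) (2 * m)"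

text \<open>
  These are the Faber-Schauder coefficients of \<open>y\<close>, that is, its second differences at dyadic
  points up to the factor \<open>-1/2\<close>.
\<close>

definition midpoint_defect :: "(real \<Rightarrow> real) \<Rightarrow> nat \<Rightarrow> nat \<Rightarrow> real" where
  "midpoint_defect y k m =
     y (dyadic (k + 1) (2 * m + 1)) - (y (dyadic k m) + y (dyadic k (m + 1))) / 2"

lemma dyadic_interval_subset:
  assumes "dyadic k (Suc n) \<le> T"
  shows "dyadic_interval k n \<subseteq> {0..T}"
  using assms by (auto simp: dyadic_interval_def intro: order_trans[OF dyadic_nonneg])

lemma height_near_holder:
  assumes cont: "continuous_on {0..T} x" and "0 < \<alpha>" "0 \<le> C"
    and C: "\<And>s t. s \<in> {0..T} \<Longrightarrow> t \<in> {0..T} \<Longrightarrow> \<bar>x s - x t\<bar> \<le> C * \<bar>s - t\<bar> powr \<alpha>"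
    and T: "dyadic k (Suc n) \<le> T" and t: "t \<in> {0..T}"
    and \<delta>: "\<bar>dyadic k n - t\<bar> \<le> \<delta>" "\<bar>dyadic k (Suc n) - t\<bar> \<le> \<delta>"
  shows "\<bar>height x k n - x t\<bar> \<le> C * \<delta> powr \<alpha>"
proof (rule height_near)
  show "continuous_on (dyadic_interval k n) x"
    using cont dyadic_interval_subset[OF T] by (rule continuous_on_subset)
  fix u assume u: "u \<in> dyadic_interval k n"
  then have "\<bar>x u - x t\<bar> \<le> C * \<bar>u - t\<bar> powr \<alpha>"
    using C dyadic_interval_subset[OF T] t by blast
  also have "\<dots> \<le> C * \<delta> powr \<alpha>"
    using u \<delta> assms(2,3) by (intro mult_left_mono powr_mono2) (auto simp: dyadic_interval_def)
  finally show "\<bar>x u - x t\<bar> \<le> C * \<delta> powr \<alpha>" .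
qed

lemma haar_diff_bound:
  assumes cont: "continuous_on {0..T} x" and "0 < \<alpha>" "0 \<le> C"
    and C: "\<And>s t. s \<in> {0..T} \<Longrightarrow> t \<in> {0..T} \<Longrightarrow> \<bar>x s - x t\<bar> \<le> C * \<bar>s - t\<bar> powr \<alpha>"
    and T: "dyadic k (Suc m) \<le> T"
  shows "\<bar>haar_diff x k m\<bar> \<le> 2 * C * (2 powr - \<alpha>) ^ k"
proof -
  define t where "t = dyadic (Suc k) (2 * m + 1)"
  have r: "dyadic (Suc k) (Suc (2 * m + 1)) = dyadic k (Suc m)"
    using dyadic_double[of k "Suc m"] by simp
  have "t \<le> dyadic (Suc k) (Suc (2 * m + 1))" unfolding t_def by (rule dyadic_mono) simp
  then have t: "t \<in> {0..T}" using T r by (auto simp: t_def)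
  have "\<bar>height x (Suc k) (2 * m) - x t\<bar> \<le> C * (1 / 2 ^ k) powr \<alpha>"
    by (rule height_near_holder[OF cont assms(2,3) C _ t])
      (use t in \<open>auto simp: t_def dyadic_def field_simps\<close>)
  moreover have "\<bar>height x (Suc k) (2 * m + 1) - x t\<bar> \<le> C * (1 / 2 ^ k) powr \<alpha>"
    by (rule height_near_holder[OF cont assms(2,3) C _ t])
      (use T r in \<open>auto simp: t_def\<close>, auto simp: dyadic_def field_simps)
  ultimately show ?thesis
    unfolding dyadic_powr by (simp add: haar_diff_def)
qed

lemma midpoint_defect_bound:
  assumes "0 < \<beta>" "0 \<le> C"
    and C: "\<And>s t. s \<in> {0..T} \<Longrightarrow> t \<in> {0..T} \<Longrightarrow> \<bar>y s - y t\<bar> \<le> C * \<bar>s - t\<bar> powr \<beta>"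
    and T: "dyadic k (Suc m) \<le> T"
  shows "\<bar>midpoint_defect y k m\<bar> \<le> C * (2 powr - \<beta>) ^ k"
proof -
  define t where "t = dyadic (Suc k) (2 * m + 1)"
  have le: "dyadic k m \<le> t" "t \<le> dyadic k (Suc m)"
    by (auto simp: t_def dyadic_def field_simps)
  have d: "\<bar>t - dyadic k m\<bar> \<le> 1 / 2 ^ k" "\<bar>t - dyadic k (Suc m)\<bar> \<le> 1 / 2 ^ k"
    using le by (auto simp: dyadic_Suc)
  have mem: "dyadic k m \<in> {0..T}" "dyadic k (Suc m) \<in> {0..T}" "t \<in> {0..T}"
    using le T by (auto simp: t_def)
  have "\<bar>y t - y s\<bar> \<le> C * (2 powr - \<beta>) ^ k" if "s \<in> {0..T}" "\<bar>t - s\<bar> \<le> 1 / 2 ^ k" for s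
  proof -
    have "\<bar>y t - y s\<bar> \<le> C * \<bar>t - s\<bar> powr \<beta>" using C mem that by blast
    also have "\<dots> \<le> C * (1 / 2 ^ k) powr \<beta>"
      using that assms by (intro mult_left_mono powr_mono2) auto
    finally show ?thesis by (simp add: dyadic_powr)
  qed
  note near = this[OF mem(1) d(1)] this[OF mem(2) d(2)]
  have "\<bar>r - (p + q) / 2\<bar> \<le> e" if "\<bar>r - p\<bar> \<le> e" "\<bar>r - q\<bar> \<le> e" for p q r e :: real
    using that unfolding abs_le_iff by (simp add: field_simps)
  from this[OF near] show ?thesis by (simp add: midpoint_defect_def t_def)
qed

section \<open>The approximating sums as Riemann sums\<close>

definition riemann_sum :: "(real \<Rightarrow> real) \<Rightarrow> (real \<Rightarrow> real) \<Rightarrow> nat \<Rightarrow> nat \<Rightarrow> real" where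
  "riemann_sum x y k M =
     (\<Sum>n<M. height x k n * (y (dyadic k (Suc n)) - y (dyadic k n)))"

text \<open>
  Passing to the next level replaces \<open>h\<close> by \<open>h - d/2\<close> and \<open>h + d/2\<close> on the two halves of a cell,
  where \<open>d\<close> is the Haar difference.  The terms with \<open>h\<close> telescope, and the coefficient of \<open>d\<close> is
  minus the midpoint defect of \<open>y\<close>.
\<close>

lemma riemann_sum_refine:
  assumes "\<And>m. m < M \<Longrightarrow> continuous_on (dyadic_interval k m) x"
  shows "riemann_sum x y (Suc k) (2 * M) =
    riemann_sum x y k M - (\<Sum>m<M. haar_diff x k m * midpoint_defect y k m)"
  using assms
proof (induction M)
  case 0
  then show ?case by (simp add: riemann_sum_def)
next
  case (Suc M)
  have right: "dyadic (Suc k) (Suc (Suc (2 * M))) = dyadic k (Suc M)"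
    using dyadic_double[of k "Suc M"] by simp
  have "riemann_sum x y (Suc k) (2 * Suc M) = riemann_sum x y (Suc k) (2 * M)
      + height x (Suc k) (2 * M) * (y (dyadic (Suc k) (Suc (2 * M))) - y (dyadic k M))
      + height x (Suc k) (Suc (2 * M)) * (y (dyadic k (Suc M)) - y (dyadic (Suc k) (Suc (2 * M))))"
    by (simp add: riemann_sum_def dyadic_double right)
  moreover have "riemann_sum x y k (Suc M) = riemann_sum x y k M
      + (height x (Suc k) (2 * M) + height x (Suc k) (Suc (2 * M))) / 2
        * (y (dyadic k (Suc M)) - y (dyadic k M))"
    using height_average[OF Suc.prems[of M]] by (simp add: riemann_sum_def)
  ultimately show ?case
    using Suc.IH Suc.prems
    by (simp add: haar_diff_def midpoint_defect_def field_simps)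
qed

text \<open>
  For \<open>M = 0\<close> the truncated index \<open>M - 1 = 0\<close> makes the two boundary terms cancel.
\<close>

lemma abel_summation:
  "(\<Sum>n = 1..M - 1. y (dyadic k n) * (height x k n - height x k (n - 1))) =
    y (dyadic k M) * height x k (M - 1) - y 0 * height x k 0 - riemann_sum x y k M"
proof (induction M)
  case 0
  then show ?case by (simp add: riemann_sum_def)
next
  case (Suc M)
  then show ?case
    by (cases M) (simp_all add: riemann_sum_def algebra_simps)
qed

definition cells_upto :: "nat \<Rightarrow> real \<Rightarrow> nat" where
  "cells_upto k t = nat \<lfloor>2 ^ k * t\<rfloor>"

lemma le_cells_upto_iff: "m \<le> cells_upto k t \<longleftrightarrow> dyadic k m \<le> t" if "0 \<le> t"
  using that unfolding cells_upto_def dyadic_def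
  by (simp add: le_nat_iff le_floor_iff divide_le_eq mult.commute)

lemma dyadic_interval_subset_iff:
  "dyadic_interval k n \<subseteq> {a..b} \<longleftrightarrow> a \<le> dyadic k n \<and> dyadic k (Suc n) \<le> b"
  using dyadic_mono[of n "Suc n" k] by (auto simp: dyadic_interval_def)

text \<open>
  An index belongs to the set if and only if the cell of level \<open>k\<close> above it lies in \<open>[0,t]\<close>; as
  \<open>t \<le> 1\<close>, such an index is less than \<open>2\<close> to the power \<open>k + 1\<close>.
\<close>

lemma index_set_eq:
  assumes "0 \<le> t" "t \<le> 1"
  shows "index_set 0 t (Suc k) = {..<2 * cells_upto k t}"
proof -
  have "n \<le> 2 * 2 ^ k" if "Suc (n div 2) \<le> cells_upto k t" for n
  proof -
    have "dyadic k (Suc (n div 2)) \<le> 1"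
      using that assms le_cells_upto_iff by force
    then have "real (Suc (n div 2)) \<le> real (2 ^ k)"
      by (simp add: dyadic_def)
    then have "Suc (n div 2) \<le> 2 ^ k" by (simp only: of_nat_le_iff)
    then show ?thesis by linarith
  qed
  moreover have "Suc (n div 2) \<le> cells_upto k t \<longleftrightarrow> n < 2 * cells_upto k t" for n
    by linarith
  ultimately show ?thesis
    by (auto simp: index_set_def dyadic_interval_subset_iff le_cells_upto_iff[OF assms(1), symmetric])
qed

lemma approx_sum_eq:
  assumes "0 \<le> t" "t \<le> 1"
  shows "approx_sum x y 0 t (Suc k) =
    y (dyadic k (cells_upto k t)) * height x (Suc k) (2 * cells_upto k t - 1)
      - y 0 * height x (Suc k) 0 - riemann_sum x y (Suc k) (2 * cells_upto k t)"
proof (cases "cells_upto k t = 0")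
  case True
  then show ?thesis
    by (simp add: approx_sum_def index_set_eq[OF assms] riemann_sum_def)
next
  case False
  have "Min {..<2 * cells_upto k t} = 0"
    by (rule Min_eqI) (use False in auto)
  moreover have "Max {..<2 * cells_upto k t} = 2 * cells_upto k t - 1"
    by (rule Max_eqI) (use False in auto)
  moreover have "{..<2 * cells_upto k t} \<noteq> {}"
    using False by (auto simp: lessThan_empty_iff)
  ultimately show ?thesis
    using abel_summation[where M="2 * cells_upto k t" and k="Suc k" and x=x and y=y]
    by (simp add: approx_sum_def index_set_eq[OF assms] dyadic_double)
qed

lemma cells_upto_near:
  assumes "0 \<le> t"
  shows "dyadic k (cells_upto k t) \<le> t" "t < dyadic k (cells_upto k t) + 1 / 2 ^ k"
proof -
  show "dyadic k (cells_upto k t) \<le> t"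
    using le_cells_upto_iff[OF assms, of "cells_upto k t" k] by simp
  show "t < dyadic k (cells_upto k t) + 1 / 2 ^ k"
    using le_cells_upto_iff[OF assms, of "Suc (cells_upto k t)" k] by (simp add: dyadic_Suc)
qed

lemma cells_upto_mono: "0 \<le> s \<Longrightarrow> s \<le> t \<Longrightarrow> cells_upto k s \<le> cells_upto k t"
  using cells_upto_near(1)[of s k] by (simp add: le_cells_upto_iff)

lemma cells_upto_diff:
  assumes "0 \<le> s" "s \<le> t"
  shows "real (cells_upto k t - cells_upto k s) \<le> 2 ^ k * (t - s) + 1"
proof -
  have "dyadic k (cells_upto k t) - dyadic k (cells_upto k s) \<le> t - s + 1 / 2 ^ k"
    using cells_upto_near[of s k] cells_upto_near[of t k] assms by simp
  then have "2 ^ k * (dyadic k (cells_upto k t) - dyadic k (cells_upto k s))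
      \<le> 2 ^ k * (t - s + 1 / 2 ^ k)" by (rule mult_left_mono) simp
  then have "real (cells_upto k t) - real (cells_upto k s) \<le> 2 ^ k * (t - s) + 1"
    by (simp add: dyadic_def right_diff_distrib distrib_left)
  then show ?thesis using cells_upto_mono[OF assms, of k] by (simp add: of_nat_diff)
qed

lemma cells_upto_Suc:
  assumes "0 \<le> t"
  shows "cells_upto (Suc k) t = 2 * cells_upto k t \<or> cells_upto (Suc k) t = Suc (2 * cells_upto k t)"
proof -
  have "2 * cells_upto k t \<le> cells_upto (Suc k) t"
    using cells_upto_near(1)[OF assms, of k]
    by (simp add: le_cells_upto_iff[OF assms] dyadic_double)
  moreover have "\<not> 2 * Suc (cells_upto k t) \<le> cells_upto (Suc k) t"
    unfolding le_cells_upto_iff[OF assms] dyadic_double using cells_upto_near(2)[OF assms, of k]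
    by (simp add: dyadic_Suc)
  ultimately show ?thesis by arith
qed

lemma tendsto_of_holder:
  assumes "f \<in> holder \<gamma> T" "0 < \<gamma>" "\<And>k. u k \<in> {0..T}" "t \<in> {0..T}"
    "\<And>k. \<bar>u k - t\<bar> \<le> 1 / 2 ^ k"
  shows "(\<lambda>k. f (u k)) \<longlonglongrightarrow> f t"
proof -
  have "(\<lambda>k. (1/2::real) ^ k) \<longlonglongrightarrow> 0" by (rule LIMSEQ_power_zero) simp
  then have "(\<lambda>k. u k - t) \<longlonglongrightarrow> 0"
    by (rule Lim_null_comparison[rotated]) (use assms(5) in \<open>simp add: power_divide\<close>)
  then have "u \<longlonglongrightarrow> t" by (simp add: LIM_zero_iff)
  with holder_continuous_on[OF assms(1,2)] assms(3,4) show ?thesis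
    by (auto simp: continuous_on_sequentially comp_def)
qed

lemma height_tendsto:
  assumes x: "x \<in> holder \<alpha> T" and "0 < \<alpha>" and t: "t \<in> {0..T}"
    and T: "\<And>k. k \<ge> K \<Longrightarrow> dyadic (Suc k) (Suc (n k)) \<le> T"
    and near: "\<And>k. k \<ge> K \<Longrightarrow> \<bar>dyadic (Suc k) (n k) - t\<bar> \<le> 2 / 2 ^ k"
      "\<And>k. k \<ge> K \<Longrightarrow> \<bar>dyadic (Suc k) (Suc (n k)) - t\<bar> \<le> 2 / 2 ^ k"
  shows "(\<lambda>k. height x (Suc k) (n k)) \<longlonglongrightarrow> x t"
proof -
  obtain C where C: "0 \<le> C"
    "\<And>s t. s \<in> {0..T} \<Longrightarrow> t \<in> {0..T} \<Longrightarrow> \<bar>x s - x t\<bar> \<le> C * \<bar>s - t\<bar> powr \<alpha>"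
    using holderE[OF x] by metis
  have "(\<lambda>k. (1/2::real) ^ k) \<longlonglongrightarrow> 0" by (rule LIMSEQ_power_zero) simp
  then have "(\<lambda>k. C * (2 * (1/2) ^ k) powr \<alpha>) \<longlonglongrightarrow> C * (2 * 0) powr \<alpha>"
    using \<open>0 < \<alpha>\<close> by (intro tendsto_intros tendsto_powr2) auto
  then have "(\<lambda>k. C * (2 / 2 ^ k) powr \<alpha>) \<longlonglongrightarrow> 0" by (simp add: power_divide)
  then have "(\<lambda>k. height x (Suc k) (n k) - x t) \<longlonglongrightarrow> 0"
  proof (rule Lim_null_comparison[rotated])
    show "\<forall>\<^sub>F k in sequentially. norm (height x (Suc k) (n k) - x t) \<le> C * (2 / 2 ^ k) powr \<alpha>"
      using eventually_ge_at_top[of K]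
    proof eventually_elim
      case (elim k)
      then show ?case
        using height_near_holder[OF holder_continuous_on[OF x \<open>0 < \<alpha>\<close>] \<open>0 < \<alpha>\<close> C T t near]
        by auto
    qed
  qed
  then show ?thesis by (simp add: LIM_zero_iff)
qed

text \<open>
  In the limit the boundary terms of the summation by parts become \<open>y t * x t - y 0 * x 0\<close>,
  so that the integral of \<open>y\<close> against \<open>x\<close> is governed by Riemann sums of \<open>x\<close> against \<open>y\<close>.
\<close>

lemma approx_sum_tendsto:
  assumes x: "x \<in> holder \<alpha> T" and y: "y \<in> holder \<beta> T" and "0 < \<alpha>" "0 < \<beta>"
    and t: "t \<in> {0..T}" and "T \<le> 1"
    and R: "(\<lambda>k. riemann_sum x y (Suc k) (2 * cells_upto k t)) \<longlonglongrightarrow> I"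
  shows "approx_sum x y 0 t \<longlonglongrightarrow> y t * x t - y 0 * x 0 - I"
proof (cases "t = 0")
  case True
  then have "riemann_sum x y (Suc k) (2 * cells_upto k t) = 0" for k
    by (simp add: riemann_sum_def cells_upto_def)
  with R have "I = 0" by (simp add: LIMSEQ_const_iff)
  moreover have "\<not> dyadic (k - 1) (Suc n) \<le> t" for k n
    using True by (simp add: dyadic_Suc add_nonneg_pos not_le)
  then have "index_set 0 t k = {}" for k
    by (simp add: index_set_def dyadic_interval_subset_iff)
  ultimately show ?thesis using True by (simp add: approx_sum_def[abs_def])
next
  case False
  with t have "0 < t" by simp
  then obtain k0 :: nat where k0: "(1/2) ^ k0 < t"
    using real_arch_pow_inv[of t "1/2"] by auto
  have cells: "1 \<le> cells_upto k t" if "k0 \<le> k" for k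
  proof -
    have "(1/2::real) ^ k \<le> (1/2) ^ k0" using that by (intro power_decreasing) auto
    with k0 have "dyadic k 1 \<le> t" by (simp add: dyadic_def power_divide)
    then show ?thesis using le_cells_upto_iff[of t 1 k] \<open>0 < t\<close> by simp
  qed
  have near: "dyadic k (cells_upto k t) \<le> t" "t < dyadic k (cells_upto k t) + 1 / 2 ^ k" for k
    using cells_upto_near \<open>0 < t\<close> by auto
  have "(\<lambda>k. y (dyadic k (cells_upto k t))) \<longlonglongrightarrow> y t"
  proof (rule tendsto_of_holder[OF y \<open>0 < \<beta>\<close> _ t])
    fix k
    show "dyadic k (cells_upto k t) \<in> {0..T}" "\<bar>dyadic k (cells_upto k t) - t\<bar> \<le> 1 / 2 ^ k"
      using near[of k] t by (auto intro: order_trans)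
  qed
  moreover have "(\<lambda>k. height x (Suc k) (2 * cells_upto k t - 1)) \<longlonglongrightarrow> x t"
  proof (rule height_tendsto[OF x \<open>0 < \<alpha>\<close> t, where K=k0])
    fix k assume "k0 \<le> k"
    then have right: "dyadic (Suc k) (Suc (2 * cells_upto k t - 1)) = dyadic k (cells_upto k t)"
      using cells[of k] dyadic_double by simp
    then show "dyadic (Suc k) (Suc (2 * cells_upto k t - 1)) \<le> T"
      "\<bar>dyadic (Suc k) (Suc (2 * cells_upto k t - 1)) - t\<bar> \<le> 2 / 2 ^ k"
      using near[of k] t by auto
    show "\<bar>dyadic (Suc k) (2 * cells_upto k t - 1) - t\<bar> \<le> 2 / 2 ^ k"
    proof -
      define e :: real where "e = 1 / 2 ^ k"
      have "0 < e" by (simp add: e_def)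
      moreover have "dyadic (Suc k) (2 * cells_upto k t - 1) = dyadic k (cells_upto k t) - e / 2"
        using right dyadic_Suc[of "Suc k" "2 * cells_upto k t - 1"] by (simp add: e_def)
      moreover have "t < dyadic k (cells_upto k t) + e" using near[of k] by (simp add: e_def)
      moreover have "2 / 2 ^ k = 2 * e" by (simp add: e_def)
      ultimately show ?thesis using near(1)[of k] unfolding abs_le_iff by linarith
    qed
  qed
  moreover have "(\<lambda>k. height x (Suc k) 0) \<longlonglongrightarrow> x 0"
  proof (rule height_tendsto[OF x \<open>0 < \<alpha>\<close>, where K=k0])
    fix k assume "k0 \<le> k"
    have "dyadic (Suc k) (Suc 0) \<le> dyadic k (cells_upto k t)"
      using dyadic_mono[of "Suc 0" "2 * cells_upto k t" "Suc k"] cells[OF \<open>k0 \<le> k\<close>]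
      unfolding dyadic_double by simp
    then show "dyadic (Suc k) (Suc 0) \<le> T" using near[of k] t by simp
    show "\<bar>dyadic (Suc k) (Suc 0) - 0\<bar> \<le> 2 / 2 ^ k" "\<bar>dyadic (Suc k) 0 - 0\<bar> \<le> 2 / 2 ^ k"
      by (auto simp: dyadic_def field_simps)
  qed (use t in auto)
  ultimately have "(\<lambda>k. approx_sum x y 0 t (Suc k)) \<longlonglongrightarrow> y t * x t - y 0 * x 0 - I"
    using t \<open>T \<le> 1\<close> R by (subst approx_sum_eq) (auto intro!: tendsto_intros)
  then show ?thesis by (rule LIMSEQ_imp_Suc)
qed

text \<open>
  The integral of the constant \<open>1\<close> is the increment of \<open>x\<close>, so that the hypothesis forces every
  \<open>\<alpha>\<close>-Hoelder function to be \<open>\<beta>\<close>-Hoelder.  The power \<open>t\<close> to the \<open>\<alpha>\<close> is not if \<open>\<alpha> < \<beta>\<close>.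
\<close>

lemma exponent_le_of_T_maps:
  assumes "0 < \<alpha>" "\<alpha> \<le> 1" "0 < \<beta>" "0 < T" "T \<le> 1"
    and T: "\<And>x. x \<in> holder \<alpha> T \<Longrightarrow> T_op_maps_holder \<beta> T y0 x"
  shows "\<beta> \<le> \<alpha>"
proof (rule ccontr)
  assume "\<not> \<beta> \<le> \<alpha>"
  define x :: "real \<Rightarrow> real" where "x = (\<lambda>t. t powr \<alpha>)"
  have x: "x \<in> holder \<alpha> T" unfolding x_def by (rule holder_powr) fact+
  have one: "(\<lambda>_. 1) \<in> holder \<beta> T" by (rule holder_const)
  have "T_op y0 x (\<lambda>_. 1) t = y0 + x t" if t: "t \<in> {0..T}" for t
  proof -
    have "approx_sum x (\<lambda>_. 1) 0 t \<longlonglongrightarrow> 1 * x t - 1 * x 0 - 0"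
      using assms by (intro approx_sum_tendsto[OF x one _ _ t]) (auto simp: riemann_sum_def)
    then show ?thesis by (simp add: T_op_def dyadic_integral_def limI x_def)
  qed
  then have "(\<lambda>t. y0 + x t) \<in> holder \<beta> T"
    using T[OF x] one holder_cong[of T "T_op y0 x (\<lambda>_. 1)" "\<lambda>t. y0 + x t" \<beta>]
    unfolding T_op_maps_holder_def by blast
  then obtain C where C: "0 \<le> C" "\<And>s t. s \<in> {0..T} \<Longrightarrow> t \<in> {0..T} \<Longrightarrow>
      \<bar>(y0 + x s) - (y0 + x t)\<bar> \<le> C * \<bar>s - t\<bar> powr \<beta>"
    using holderE by metis
  have bound: "1 \<le> C * t powr (\<beta> - \<alpha>)" if "0 < t" "t \<le> T" for t
  proof -
    have "t powr \<alpha> \<le> C * t powr \<beta>" using C(2)[of t 0] that by (simp add: x_def)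
    then show ?thesis using that by (simp add: powr_diff field_simps)
  qed
  have "((\<lambda>t. C * t powr (\<beta> - \<alpha>)) \<longlongrightarrow> C * 0 powr (\<beta> - \<alpha>)) (at_right 0)"
    using \<open>\<not> \<beta> \<le> \<alpha>\<close>
    by (intro tendsto_intros tendsto_powr2) (auto simp: eventually_at_filter)
  moreover have "\<forall>\<^sub>F t in at_right 0. 1 \<le> C * t powr (\<beta> - \<alpha>)"
    using eventually_at_right_less[of 0] eventually_at_right_real[OF \<open>0 < T\<close>]
    by eventually_elim (use bound in auto)
  ultimately have "1 \<le> C * 0 powr (\<beta> - \<alpha>)"
    by (intro tendsto_lowerbound) auto
  then show False by simp
qed

section \<open>Exponents with sum above one\<close>

lemma geometric_increments:
  fixes z :: "nat \<Rightarrow> real"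
  assumes "0 \<le> r" "r < 1" "0 \<le> q" "q < 1" "0 \<le> A" "0 \<le> B"
    and inc: "\<And>k. \<bar>z (Suc k) - z k\<bar> \<le> A * r ^ k + B * q ^ k"
  shows "convergent z" "\<bar>lim z - z K\<bar> \<le> A * r ^ K / (1 - r) + B * q ^ K / (1 - q)"
proof -
  have sums: "(\<lambda>j. A * r ^ K * r ^ j + B * q ^ K * q ^ j)
      sums (A * r ^ K * (1 / (1 - r)) + B * q ^ K * (1 / (1 - q)))" for K
    using assms by (intro sums_add sums_mult geometric_sums) auto
  have inc': "norm (z (Suc (j + K)) - z (j + K)) \<le> A * r ^ K * r ^ j + B * q ^ K * q ^ j" for j K
    using inc[of "j + K"] by (simp add: power_add mult_ac)
  have summable: "summable (\<lambda>j. norm (z (Suc (j + K)) - z (j + K)))" for K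
    by (rule summable_comparison_test'[OF sums_summable[OF sums[of K]], where N=0])
      (use inc' in auto)
  have tele: "(\<Sum>j<n. z (Suc (j + K)) - z (j + K)) = z (n + K) - z K" for n K
    by (induction n) auto
  have conv: "convergent (\<lambda>n. z (n + K) - z K)" for K
    using summable_norm_cancel[OF summable[of K]]
    by (simp add: summable_iff_convergent tele)
  from conv[of 0] have "convergent (\<lambda>n. (z n - z 0) + z 0)"
    by (intro convergent_add convergent_const) simp
  then show z: "convergent z" by simp
  then have "(\<lambda>n. z (n + K) - z K) \<longlonglongrightarrow> lim z - z K"
    by (intro tendsto_diff tendsto_const LIMSEQ_ignore_initial_segment)
      (simp add: convergent_LIMSEQ_iff)
  then have "(\<lambda>j. z (Suc (j + K)) - z (j + K)) sums (lim z - z K)"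
    by (simp add: sums_def tele)
  then have "lim z - z K = (\<Sum>j. z (Suc (j + K)) - z (j + K))" by (simp add: sums_iff)
  also have "norm \<dots> \<le> (\<Sum>j. norm (z (Suc (j + K)) - z (j + K)))"
    by (rule summable_norm[OF summable])
  also have "\<dots> \<le> (\<Sum>j. A * r ^ K * r ^ j + B * q ^ K * q ^ j)"
    by (rule suminf_le[OF inc' summable sums_summable[OF sums]])
  also have "\<dots> = A * r ^ K / (1 - r) + B * q ^ K / (1 - q)"
    using sums[of K] by (simp add: sums_iff)
  finally show "\<bar>lim z - z K\<bar> \<le> A * r ^ K / (1 - r) + B * q ^ K / (1 - q)" by simp
qed

lemma decay_product: "2 * ((2 powr - \<alpha>) * (2 powr - \<beta>)) = (2::real) powr (1 - (\<alpha> + \<beta>))"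
  by (simp add: powr_diff powr_minus powr_add field_simps)

lemma sum_cells_bound:
  fixes g :: "nat \<Rightarrow> real"
  assumes "0 \<le> s" "s \<le> t"
    and g: "\<And>n. cells_upto k s \<le> n \<Longrightarrow> n < cells_upto k t \<Longrightarrow> \<bar>g n\<bar> \<le> c"
    and "0 \<le> c"
  shows "\<bar>(\<Sum>n<cells_upto k t. g n) - (\<Sum>n<cells_upto k s. g n)\<bar> \<le> (2 ^ k * (t - s) + 1) * c"
proof -
  have "(\<Sum>n<cells_upto k t. g n) - (\<Sum>n<cells_upto k s. g n)
      = (\<Sum>n = cells_upto k s..<cells_upto k t. g n)"
    using cells_upto_mono[OF assms(1,2)] sum_diff_nat_ivl[of 0 "cells_upto k s" "cells_upto k t" g]
    by (simp add: lessThan_atLeast0)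
  also have "\<bar>\<dots>\<bar> \<le> (\<Sum>n = cells_upto k s..<cells_upto k t. \<bar>g n\<bar>)"
    by (rule sum_abs)
  also have "\<dots> \<le> (\<Sum>n = cells_upto k s..<cells_upto k t. c)"
    by (rule sum_mono) (use g in auto)
  also have "\<dots> \<le> (2 ^ k * (t - s) + 1) * c"
    using cells_upto_diff[OF assms(1,2), of k] \<open>0 \<le> c\<close> by (simp add: mult_right_mono)
  finally show ?thesis .
qed

text \<open>
  Passing from level \<open>k\<close> to level \<open>k + 1\<close> changes the Riemann sum over \<open>[s,t]\<close> by about
  \<open>2\<^sup>k (t - s)\<close> products of a Haar difference of \<open>x\<close> with a midpoint defect of \<open>y\<close>, each of
  order \<open>2\<close> to the power \<open>-k (\<alpha> + \<beta>)\<close>, and by boundary terms of order \<open>2\<close> to the power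
  \<open>-k \<beta>\<close>.  Both contributions are geometric in \<open>k\<close> when \<open>\<alpha> + \<beta> > 1\<close>.  Hence the sums
  converge, and starting the telescoping at the level with \<open>2\<^sup>-\<^sup>k\<close> comparable to \<open>t - s\<close>,
  where only boundedly many cells meet \<open>[s,t]\<close>, shows that the limit is Hoelder continuous.
\<close>

lemma riemann_sum_limit:
  assumes x: "x \<in> holder \<alpha> T" and y: "y \<in> holder \<beta> T"
    and "0 < \<alpha>" "0 < \<beta>" "\<beta> \<le> 1" "1 < \<alpha> + \<beta>" "T \<le> 1"
  shows "\<exists>I \<in> holder \<beta> T. \<forall>t \<in> {0..T}.
    (\<lambda>k. riemann_sum x y (Suc k) (2 * cells_upto k t)) \<longlonglongrightarrow> I t"
proof -
  note cont = holder_continuous_on[OF x \<open>0 < \<alpha>\<close>]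
  obtain C where C: "0 \<le> C"
    "\<And>s t. s \<in> {0..T} \<Longrightarrow> t \<in> {0..T} \<Longrightarrow> \<bar>x s - x t\<bar> \<le> C * \<bar>s - t\<bar> powr \<alpha>"
    using holderE[OF x] by metis
  obtain D where D: "0 \<le> D"
    "\<And>s t. s \<in> {0..T} \<Longrightarrow> t \<in> {0..T} \<Longrightarrow> \<bar>y s - y t\<bar> \<le> D * \<bar>s - t\<bar> powr \<beta>"
    using holderE[OF y] by metis
  obtain X where X: "0 \<le> X" "\<And>t. t \<in> {0..T} \<Longrightarrow> \<bar>x t\<bar> \<le> X"
    using holder_bounded[OF x \<open>0 < \<alpha>\<close>] by metis
  define p q r where "p = (2::real) powr - \<alpha>" and "q = (2::real) powr - \<beta>"
    and "r = 2 * (p * q)"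
  have p: "0 < p" "p \<le> 1" and q: "0 < q" "q < 1" and r: "0 < r" "r < 1"
    using assms powr_less_cancel_iff[of 2 "- \<beta>" 0] powr_le_cancel_iff[of 2 "- \<alpha>" 0]
      powr_less_cancel_iff[of 2 "1 - (\<alpha> + \<beta>)" 0]
    by (auto simp: p_def q_def r_def decay_product)
  have inside: "dyadic k (Suc m) \<le> T" if "m < cells_upto k t" "t \<in> {0..T}" for k m t
    using that le_cells_upto_iff[of t "Suc m" k] by auto
  have height_le: "\<bar>height x k n\<bar> \<le> X" if n: "dyadic k (Suc n) \<le> T" for k n
  proof -
    have "\<bar>height x k n - 0\<bar> \<le> X"
      by (rule height_near) (use X dyadic_interval_subset[OF n] in
        \<open>auto intro: continuous_on_subset[OF cont]\<close>)
    then show ?thesis by simp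
  qed
  have step_le: "\<bar>height x k n * (y (dyadic k (Suc n)) - y (dyadic k n))\<bar> \<le> X * (D * q ^ k)"
    if n: "dyadic k (Suc n) \<le> T" for k n
  proof -
    have "dyadic k n \<le> T" using n dyadic_mono[of n "Suc n" k] by simp
    then have "\<bar>y (dyadic k (Suc n)) - y (dyadic k n)\<bar> \<le> D * (1 / 2 ^ k) powr \<beta>"
      using D(2)[of "dyadic k (Suc n)" "dyadic k n"] n by (simp add: dyadic_Suc)
    with height_le[OF n] X(1) show ?thesis
      unfolding abs_mult q_def dyadic_powr by (intro mult_mono) auto
  qed
  \<comment> \<open>The approximating sums at level \<open>k + 1\<close> use \<open>2 * cells_upto k t\<close> cells, whereas consecutive
    sums \<open>P\<close> are comparable; the two differ by \<open>E\<close>, which tends to zero.\<close>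
  define P where "P k t = riemann_sum x y k (cells_upto k t)" for k t
  define E where "E k t = (\<Sum>m<cells_upto k t. haar_diff x k m * midpoint_defect y k m)" for k t
  have refine: "riemann_sum x y (Suc k) (2 * cells_upto k t) = P k t - E k t" if "t \<in> {0..T}" for k t
    unfolding P_def E_def
    by (rule riemann_sum_refine)
      (use inside that dyadic_interval_subset in \<open>blast intro: continuous_on_subset[OF cont]\<close>)
  have boundary: "\<bar>P (Suc k) t - (P k t - E k t)\<bar> \<le> X * D * q ^ k" if t: "t \<in> {0..T}" for k t
  proof -
    have "cells_upto (Suc k) t = 2 * cells_upto k t \<or>
        cells_upto (Suc k) t = Suc (2 * cells_upto k t)"
      using cells_upto_Suc t by simp
    then show ?thesis
    proof
      assume "cells_upto (Suc k) t = 2 * cells_upto k t"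
      then show ?thesis using refine[OF t, of k] X D q by (simp add: P_def)
    next
      assume eq: "cells_upto (Suc k) t = Suc (2 * cells_upto k t)"
      then have "dyadic (Suc k) (Suc (2 * cells_upto k t)) \<le> T"
        using inside[OF _ t, of "2 * cells_upto k t" "Suc k"] by simp
      from step_le[OF this] have "\<bar>P (Suc k) t - (P k t - E k t)\<bar> \<le> X * (D * q ^ Suc k)"
        using refine[OF t, of k] eq by (simp add: P_def riemann_sum_def)
      also have "\<dots> \<le> X * (D * q ^ k)"
        using X D q by (intro mult_left_mono power_decreasing) auto
      finally show ?thesis by (simp add: mult.assoc)
    qed
  qed
  have E_inc: "\<bar>E k t - E k s\<bar> \<le> 2 * C * D * (t - s) * r ^ k + 2 * C * D * q ^ k"
    if st: "0 \<le> s" "s \<le> t" "t \<le> T" for k s t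
  proof -
    have t: "t \<in> {0..T}" using st by auto
    have "\<bar>E k t - E k s\<bar> \<le> (2 ^ k * (t - s) + 1) * ((2 * C * p ^ k) * (D * q ^ k))"
      unfolding E_def
    proof (rule sum_cells_bound[OF st(1,2)])
      fix n assume "n < cells_upto k t"
      note n = inside[OF this t]
      show "\<bar>haar_diff x k n * midpoint_defect y k n\<bar> \<le> (2 * C * p ^ k) * (D * q ^ k)"
        unfolding abs_mult
        using haar_diff_bound[OF cont \<open>0 < \<alpha>\<close> C n] midpoint_defect_bound[OF \<open>0 < \<beta>\<close> D n]
          C D p by (intro mult_mono) (auto simp: p_def q_def)
    qed (use C D p q in auto)
    also have "\<dots> = 2 * C * D * (t - s) * r ^ k + 2 * C * D * q ^ k * p ^ k"
      by (simp add: r_def power_mult_distrib algebra_simps)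
    also have "\<dots> \<le> 2 * C * D * (t - s) * r ^ k + 2 * C * D * q ^ k * 1"
      using C D p q by (intro add_left_mono mult_left_mono power_le_one) auto
    finally show ?thesis by simp
  qed
  have zero: "P k 0 = 0" "E k 0 = 0" for k
    by (auto simp: P_def E_def riemann_sum_def cells_upto_def)
  define A B where "A = 2 * C * D" and "B = 2 * C * D + 2 * X * D"
  have AB: "0 \<le> A" "0 \<le> B" using C D X by (auto simp: A_def B_def)
  have inc: "\<bar>(P (Suc k) t - P (Suc k) s) - (P k t - P k s)\<bar> \<le> A * (t - s) * r ^ k + B * q ^ k"
    if st: "0 \<le> s" "s \<le> t" "t \<le> T" for k s t
  proof -
    have "\<bar>P (Suc k) t - (P k t - E k t)\<bar> \<le> X * D * q ^ k"
      "\<bar>P (Suc k) s - (P k s - E k s)\<bar> \<le> X * D * q ^ k"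
      using boundary st by auto
    moreover have "A * (t - s) * r ^ k + B * q ^ k =
        (2 * C * D * (t - s) * r ^ k + 2 * C * D * q ^ k) + X * D * q ^ k + X * D * q ^ k"
      by (simp add: A_def B_def algebra_simps)
    ultimately show ?thesis using E_inc[OF st, of k] by linarith
  qed
  note geometric = geometric_increments[of r q "A * (t - s)" B "\<lambda>k. P k t - P k s" for s t,
      OF less_imp_le[OF r(1)] r(2) less_imp_le[OF q(1)] q(2) _ AB(2) inc]
  have lim: "(\<lambda>k. P k t) \<longlonglongrightarrow> lim (\<lambda>k. P k t)" if t: "t \<in> {0..T}" for t
  proof -
    have "convergent (\<lambda>k. P k t - P k 0)"
      by (rule geometric) (use t AB in auto)
    then show ?thesis by (simp add: zero convergent_LIMSEQ_iff)
  qed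
  have E0: "(\<lambda>k. E k t) \<longlonglongrightarrow> 0" if t: "t \<in> {0..T}" for t
  proof (rule Lim_null_comparison)
    have "(\<lambda>k. A * (t - 0) * r ^ k + A * q ^ k) \<longlonglongrightarrow> A * (t - 0) * 0 + A * 0"
      using r q by (intro tendsto_intros LIMSEQ_power_zero) auto
    then show "(\<lambda>k. A * (t - 0) * r ^ k + A * q ^ k) \<longlonglongrightarrow> 0" by simp
    show "\<forall>\<^sub>F k in sequentially. norm (E k t) \<le> A * (t - 0) * r ^ k + A * q ^ k"
      using E_inc[of 0 t] t by (intro always_eventually) (auto simp: zero A_def)
  qed
  define I where "I t = lim (\<lambda>k. P k t)" for t
  have "(\<lambda>k. riemann_sum x y (Suc k) (2 * cells_upto k t)) \<longlonglongrightarrow> I t" if t: "t \<in> {0..T}" for t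
    using tendsto_diff[OF lim[OF t] E0[OF t]] by (simp add: refine[OF t] I_def)
  moreover have "I \<in> holder \<beta> T"
  proof (rule holderI_dyadic)
    show "0 \<le> A / (1 - r) + B / (1 - q) + 2 * X * D"
      using AB r q X D by auto
    fix s t K assume st: "0 \<le> s" "s < t" "t \<le> T" and K: "t - s \<le> 1 / 2 ^ K"
    have "(\<lambda>k. P k t - P k s) \<longlonglongrightarrow> I t - I s"
      unfolding I_def using st by (intro tendsto_diff lim) auto
    then have "lim (\<lambda>k. P k t - P k s) = I t - I s" by (rule limI)
    then have "\<bar>(I t - I s) - (P K t - P K s)\<bar>
        \<le> A * (t - s) * r ^ K / (1 - r) + B * q ^ K / (1 - q)"
      using geometric(2)[of t s K] st AB by simp
    also have "\<dots> \<le> A * q ^ K / (1 - r) + B * q ^ K / (1 - q)"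
    proof -
      have "(1/2) ^ K \<le> q ^ K"
        using \<open>\<beta> \<le> 1\<close> powr_mono[of "- 1" "- \<beta>" 2]
        by (intro power_mono) (auto simp: q_def powr_minus)
      then have "(t - s) * r ^ K \<le> q ^ K * 1"
        using K st r by (intro mult_mono power_le_one) (auto simp: power_divide)
      then have "A * ((t - s) * r ^ K) \<le> A * (q ^ K * 1)" using AB(1) by (rule mult_left_mono)
      then show ?thesis using r by (intro add_right_mono divide_right_mono) (auto simp: mult.assoc)
    qed
    finally have far: "\<bar>(I t - I s) - (P K t - P K s)\<bar> \<le> (A / (1 - r) + B / (1 - q)) * q ^ K"
      by (simp add: algebra_simps)
    have "\<bar>P K t - P K s\<bar> \<le> (2 ^ K * (t - s) + 1) * (X * (D * q ^ K))"
      unfolding P_def riemann_sum_def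
      by (rule sum_cells_bound) (use st inside[of _ K t] step_le X D q in auto)
    also have "\<dots> \<le> 2 * (X * (D * q ^ K))"
      using K X D q by (intro mult_right_mono) (auto simp: field_simps)
    finally have "\<bar>P K t - P K s\<bar> \<le> 2 * X * D * q ^ K" by simp
    with far have "\<bar>I t - I s\<bar> \<le> (A / (1 - r) + B / (1 - q)) * q ^ K + 2 * X * D * q ^ K"
      by linarith
    then show "\<bar>I t - I s\<bar> \<le> (A / (1 - r) + B / (1 - q) + 2 * X * D) * (2 powr - \<beta>) ^ K"
      by (simp add: q_def distrib_right)
  qed fact+
  ultimately show ?thesis by blast
qed

text \<open>
  Summation by parts writes the integral as \<open>x y\<close>, which is \<open>\<beta>\<close>-Hoelder because \<open>\<beta> \<le> \<alpha>\<close>, minus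
  the limit of the Riemann sums of \<open>x\<close> against \<open>y\<close>, up to a constant.
\<close>

lemma T_maps_holder:
  assumes x: "x \<in> holder \<alpha> T" and "0 < \<alpha>" "0 < \<beta>" "\<beta> \<le> 1" "\<beta> \<le> \<alpha>" "1 < \<alpha> + \<beta>" "T \<le> 1"
  shows "T_op_maps_holder \<beta> T y0 x"
  unfolding T_op_maps_holder_def
proof (intro ballI conjI)
  fix y assume y: "y \<in> holder \<beta> T"
  obtain I where I: "I \<in> holder \<beta> T" "\<And>t. t \<in> {0..T} \<Longrightarrow>
      (\<lambda>k. riemann_sum x y (Suc k) (2 * cells_upto k t)) \<longlonglongrightarrow> I t"
    using riemann_sum_limit[OF x y] assms by auto
  have lim: "approx_sum x y 0 t \<longlonglongrightarrow> y t * x t - y 0 * x 0 - I t" if "t \<in> {0..T}" for t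
    using approx_sum_tendsto[OF x y _ _ that _ I(2)[OF that]] assms by simp
  then show "dyadic_integrable x y 0 t" if "t \<in> {0..T}" for t
    using that unfolding dyadic_integrable_def by (blast intro: convergentI)
  have "(\<lambda>t. (y t * x t - I t) - (y 0 * x 0 - y0)) \<in> holder \<beta> T"
    using holder_mono[OF x] assms
    by (intro holder_diff holder_mult y I holder_const) auto
  moreover have "T_op y0 x y t = (y t * x t - I t) - (y 0 * x 0 - y0)" if "t \<in> {0..T}" for t
    using limI[OF lim[OF that]] by (simp add: T_op_def dyadic_integral_def)
  ultimately show "T_op y0 x y \<in> holder \<beta> T" by (subst holder_cong) auto
qed

text \<open>
  At most \<open>2\<^sup>k (b - a)\<close> cells of level \<open>k\<close> lie in \<open>[a,b]\<close>, which cancels the normalisation of the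
  area.
\<close>

lemma area_bound:
  assumes x: "x \<in> holder \<alpha> T" and "0 < \<alpha>"
  obtains C where "0 \<le> C" "\<And>a b k. 0 \<le> a \<Longrightarrow> a < b \<Longrightarrow> b \<le> T \<Longrightarrow>
    area x a b k \<le> C * (b - a) * (2 powr - \<alpha>) ^ k"
proof -
  note cont = holder_continuous_on[OF x \<open>0 < \<alpha>\<close>]
  obtain C where C: "0 \<le> C"
    "\<And>s t. s \<in> {0..T} \<Longrightarrow> t \<in> {0..T} \<Longrightarrow> \<bar>x s - x t\<bar> \<le> C * \<bar>s - t\<bar> powr \<alpha>"
    using holderE[OF x] by metis
  have "area x a b k \<le> C * (b - a) * (2 powr - \<alpha>) ^ k" if ab: "0 \<le> a" "a < b" "b \<le> T" for a b k
  proof -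
    define S where "S = {n. dyadic_interval k n \<subseteq> {a..b}}"
    define N where "N = nat \<lceil>2 ^ k * a\<rceil>"
    have sub: "S \<subseteq> {N..<cells_upto k b}"
    proof
      fix n assume "n \<in> S"
      then have n: "a \<le> dyadic k n" "dyadic k (Suc n) \<le> b"
        by (auto simp: S_def dyadic_interval_subset_iff)
      from n(1) have "N \<le> n"
        by (simp add: N_def dyadic_def nat_le_iff ceiling_le_iff le_divide_eq mult.commute)
      moreover have "n < cells_upto k b"
        using n(2) le_cells_upto_iff[of b "Suc n" k] ab by simp
      ultimately show "n \<in> {N..<cells_upto k b}" by simp
    qed
    have "real (card S) \<le> 2 ^ k * (b - a)"
    proof (cases "N \<le> cells_upto k b")
      case True
      have "card S \<le> cells_upto k b - N"
        using card_mono[OF _ sub] by simp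
      then have "real (card S) \<le> real (cells_upto k b) - real N" using True by linarith
      moreover have "real (cells_upto k b) \<le> 2 ^ k * b"
        using ab by (simp add: cells_upto_def)
      moreover have "2 ^ k * a \<le> real N"
        using ab by (simp add: N_def)
      ultimately show ?thesis by (simp add: right_diff_distrib)
    next
      case False
      then have "S = {}" using sub by auto
      then show ?thesis using ab by simp
    qed
    moreover have "(\<Sum>n\<in>S. \<bar>haar_diff x k n\<bar>) \<le> (\<Sum>n\<in>S. 2 * C * (2 powr - \<alpha>) ^ k)"
    proof (rule sum_mono)
      fix n assume "n \<in> S"
      then have n: "dyadic k (Suc n) \<le> T" using ab by (simp add: S_def dyadic_interval_subset_iff)
      show "\<bar>haar_diff x k n\<bar> \<le> 2 * C * (2 powr - \<alpha>) ^ k"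
        by (rule haar_diff_bound[OF cont \<open>0 < \<alpha>\<close> C n])
    qed
    ultimately have "(\<Sum>n\<in>S. \<bar>haar_diff x k n\<bar>) \<le> 2 ^ k * (b - a) * (2 * C * (2 powr - \<alpha>) ^ k)"
      using C(1) by (simp add: order_trans[OF _ mult_right_mono])
    then have "(1 / 2 ^ (k + 1)) * (\<Sum>n\<in>S. \<bar>haar_diff x k n\<bar>)
        \<le> (1 / 2 ^ (k + 1)) * (2 ^ k * (b - a) * (2 * C * (2 powr - \<alpha>) ^ k))"
      by (rule mult_left_mono) simp
    then show ?thesis
      by (simp add: area_def haar_diff_def S_def mult_ac)
  qed
  with C(1) that show thesis by blast
qed

lemma area_nonneg: "0 \<le> area x a b k"
  by (simp add: area_def sum_nonneg)

text \<open>
  The terms of the series are at most \<open>b - a\<close> times a geometric sequence, whose ratio is \<open>2\<close> to the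
  power \<open>1 - \<alpha> - \<beta>\<close>.  The factor \<open>b - a\<close>, at most \<open>2\<close> to the power \<open>1 - k0\<close>, supplies the
  required decay because \<open>\<beta> \<le> 1\<close>.
\<close>

lemma area_series_bound:
  assumes x: "x \<in> holder \<alpha> T" and "0 < \<alpha>" "0 < \<beta>" "\<beta> \<le> 1" "1 < \<alpha> + \<beta>"
  shows "\<exists>C. \<forall>a b k0. 0 \<le> a \<and> a < b \<and> b \<le> T \<and> k0 > 1 \<and>
      2 powr (- real k0 - 1) \<le> b - a \<and> b - a \<le> 2 powr (- real k0 + 1) \<longrightarrow>
    (\<lambda>k. 2 powr (real k * (1 - \<beta>)) * area x a b (k - 1)) summable_on {k0 + 1..} \<and>
    (\<Sum>\<^sub>\<infinity>k\<in>{k0 + 1..}. 2 powr (real k * (1 - \<beta>)) * area x a b (k - 1))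
      \<le> C * 2 powr (- \<beta> * real k0)"
proof -
  obtain C where C: "0 \<le> C" "\<And>a b k. 0 \<le> a \<Longrightarrow> a < b \<Longrightarrow> b \<le> T \<Longrightarrow>
      area x a b k \<le> C * (b - a) * (2 powr - \<alpha>) ^ k"
    using area_bound[OF x \<open>0 < \<alpha>\<close>] by metis
  define q r where "q = (2::real) powr - \<beta>" and "r = 2 * ((2::real) powr - \<alpha> * q)"
  have q: "0 < q" "q \<le> 1" and r: "0 < r" "r < 1"
    using assms powr_le_cancel_iff[of 2 "- \<beta>" 0] powr_less_cancel_iff[of 2 "1 - (\<alpha> + \<beta>)" 0]
    by (auto simp: q_def r_def decay_product)
  have "(\<lambda>k. 2 powr (real k * (1 - \<beta>)) * area x a b (k - 1)) summable_on {k0 + 1..} \<and>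
    (\<Sum>\<^sub>\<infinity>k\<in>{k0 + 1..}. 2 powr (real k * (1 - \<beta>)) * area x a b (k - 1))
      \<le> 4 * C / (1 - r) * 2 powr (- \<beta> * real k0)"
    if ab: "0 \<le> a" "a < b" "b \<le> T" "b - a \<le> 2 powr (- real k0 + 1)" for a b and k0 :: nat
  proof -
    define f where "f k = 2 powr (real k * (1 - \<beta>)) * area x a b (k - 1)" for k
    have f_nonneg: "0 \<le> f k" for k by (simp add: f_def area_nonneg)
    have f_le: "f (Suc j) \<le> 2 * C * (b - a) * r ^ j" for j
    proof -
      have "2 powr (real (Suc j) * (1 - \<beta>)) = (2 powr (1 - \<beta>)) ^ Suc j"
        by (subst powr_power) auto
      also have "2 powr (1 - \<beta>) = 2 * q"
        by (simp add: q_def powr_diff powr_minus field_simps)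
      finally have "f (Suc j) \<le> (2 * q) ^ Suc j * (C * (b - a) * (2 powr - \<alpha>) ^ j)"
        using C(2)[OF ab(1-3), of j] q unfolding f_def by (auto intro!: mult_left_mono)
      also have "\<dots> = 2 * C * (b - a) * r ^ j * q"
        by (simp add: r_def power_mult_distrib)
      also have "\<dots> \<le> 2 * C * (b - a) * r ^ j * 1"
        using q r C ab by (intro mult_left_mono) auto
      finally show ?thesis by simp
    qed
    have partial: "sum f F \<le> 2 * C * (b - a) / (1 - r)" if F: "finite F" "F \<subseteq> {k0 + 1..}" for F
    proof -
      have "sum f F = (\<Sum>j\<in>(\<lambda>k. k - 1) ` F. f (Suc j))"
        by (rule sum.reindex_bij_witness[where i=Suc and j="\<lambda>k. k - 1"]) (use F in \<open>auto 4 3\<close>)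
      also have "\<dots> \<le> (\<Sum>j\<in>(\<lambda>k. k - 1) ` F. 2 * C * (b - a) * r ^ j)"
        by (intro sum_mono f_le)
      also have "\<dots> = 2 * C * (b - a) * (\<Sum>j\<in>(\<lambda>k. k - 1) ` F. r ^ j)"
        by (simp add: sum_distrib_left)
      also have "\<dots> \<le> 2 * C * (b - a) * (\<Sum>j. r ^ j)"
        using F r C ab by (intro mult_left_mono sum_le_suminf summable_geometric) auto
      also have "(\<Sum>j. r ^ j) = 1 / (1 - r)" using r by (intro suminf_geometric) auto
      finally show ?thesis by simp
    qed
    have "b - a \<le> 2 * 2 powr (- \<beta> * real k0)"
    proof -
      have "2 powr (- real k0 + 1) = 2 * 2 powr (- real k0)"
        using powr_add[of 2 "- real k0" 1] by simp
      moreover have "2 powr (- real k0) \<le> 2 powr (- \<beta> * real k0)"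
        using \<open>\<beta> \<le> 1\<close> by (intro powr_mono) (auto simp: mult_left_le_one_le \<open>0 < \<beta>\<close> less_imp_le)
      ultimately show ?thesis using ab(4) by linarith
    qed
    then have "2 * C * (b - a) \<le> 2 * C * (2 * 2 powr (- \<beta> * real k0))"
      using C by (intro mult_left_mono) auto
    then have final: "2 * C * (b - a) / (1 - r) \<le> 4 * C / (1 - r) * 2 powr (- \<beta> * real k0)"
      using r divide_right_mono[of _ _ "1 - r"] by fastforce
    have "f summable_on {k0 + 1..}"
      by (rule nonneg_bdd_above_summable_on) (use f_nonneg partial in \<open>auto simp: bdd_above_def\<close>)
    moreover from this have "infsum f {k0 + 1..} \<le> 2 * C * (b - a) / (1 - r)"
      by (rule infsum_le_finite_sums) (use partial in auto)
    ultimately show ?thesis using final unfolding f_def by (auto intro: order_trans)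
  qed
  then show ?thesis by blast
qed

section \<open>Lacunary series\<close>

definition lacunary :: "real \<Rightarrow> (real \<Rightarrow> real) \<Rightarrow> real \<Rightarrow> real" where
  "lacunary \<gamma> \<psi> u = (\<Sum>j. (2 powr - \<gamma>) ^ j * \<psi> (2 ^ j * u))"

lemma two_powr_neg:
  fixes \<gamma> :: real
  shows "0 < (2::real) powr - \<gamma>" "0 < \<gamma> \<Longrightarrow> (2::real) powr - \<gamma> < 1"
  using powr_less_cancel_iff[of 2 "- \<gamma>" 0] by auto

lemma lacunary_summable:
  fixes \<gamma> :: real and \<psi> :: "real \<Rightarrow> real"
  assumes "0 < \<gamma>" "\<And>u. \<bar>\<psi> u\<bar> \<le> B"
  shows "summable (\<lambda>j. (2 powr - \<gamma>) ^ j * \<psi> (2 ^ j * u))"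
proof (rule summable_comparison_test')
  show "summable (\<lambda>j. (2 powr - \<gamma>) ^ j * B)"
    using two_powr_neg[of \<gamma>] assms(1) by (intro summable_mult2 summable_geometric) auto
  show "norm ((2 powr - \<gamma>) ^ j * \<psi> (2 ^ j * u)) \<le> (2 powr - \<gamma>) ^ j * B" for j
    using assms(2) by (simp add: abs_mult)
qed

lemma lacunary_rec:
  fixes \<gamma> :: real and \<psi> :: "real \<Rightarrow> real"
  assumes "0 < \<gamma>" "\<And>u. \<bar>\<psi> u\<bar> \<le> B"
  shows "lacunary \<gamma> \<psi> u = \<psi> u + 2 powr - \<gamma> * lacunary \<gamma> \<psi> (2 * u)"
proof -
  have "summable (\<lambda>j. (2 powr - \<gamma>) ^ j * \<psi> (2 ^ j * u))"
    by (rule lacunary_summable[OF assms])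
  from suminf_split_head[OF this]
  have "lacunary \<gamma> \<psi> u = \<psi> u + (\<Sum>j. (2 powr - \<gamma>) ^ Suc j * \<psi> (2 ^ Suc j * u))"
    by (simp add: lacunary_def)
  also have "\<dots> = \<psi> u + (\<Sum>j. 2 powr - \<gamma> * ((2 powr - \<gamma>) ^ j * \<psi> (2 ^ j * (2 * u))))"
    by (simp add: mult_ac)
  also have "(\<Sum>j. 2 powr - \<gamma> * ((2 powr - \<gamma>) ^ j * \<psi> (2 ^ j * (2 * u))))
      = 2 powr - \<gamma> * lacunary \<gamma> \<psi> (2 * u)"
    unfolding lacunary_def by (rule suminf_mult[OF lacunary_summable[OF assms]])
  finally show ?thesis .
qed

lemma lacunary_bounded:
  fixes \<gamma> :: real and \<psi> :: "real \<Rightarrow> real"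
  assumes "0 < \<gamma>" "\<And>u. \<bar>\<psi> u\<bar> \<le> B"
  shows "\<bar>lacunary \<gamma> \<psi> u\<bar> \<le> B / (1 - 2 powr - \<gamma>)"
proof -
  have "norm (lacunary \<gamma> \<psi> u) \<le> (\<Sum>j. B * (2 powr - \<gamma>) ^ j)"
    unfolding lacunary_def
  proof (rule norm_suminf_le)
    show "norm ((2 powr - \<gamma>) ^ j * \<psi> (2 ^ j * u)) \<le> B * (2 powr - \<gamma>) ^ j" for j
      using assms(2) by (simp add: abs_mult mult.commute)
    show "summable (\<lambda>j. B * (2 powr - \<gamma>) ^ j)"
      using two_powr_neg[of \<gamma>] assms(1) by (intro summable_mult summable_geometric) auto
  qed
  also have "\<dots> = B / (1 - 2 powr - \<gamma>)"
    using two_powr_neg[of \<gamma>] assms(1) by (simp add: suminf_mult summable_geometric suminf_geometric)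
  finally show ?thesis by simp
qed

text \<open>
  One application of the functional equation exchanges a distance \<open>2\<^sup>-\<^sup>K\<close> for twice that distance,
  at the price of a factor \<open>2\<close> to the power \<open>-\<gamma>\<close> and of a Lipschitz error \<open>L 2\<^sup>-\<^sup>K\<close>; after
  normalisation by \<open>2\<close> to the power \<open>K \<gamma>\<close> these errors form a convergent geometric series
  because \<open>\<gamma> < 1\<close>.
\<close>

lemma lacunary_increment:
  assumes \<gamma>: "0 < \<gamma>" "\<gamma> < 1" and B: "\<And>u. \<bar>\<psi> u\<bar> \<le> B"
    and L: "0 \<le> L" "\<And>u v. \<bar>\<psi> u - \<psi> v\<bar> \<le> L * \<bar>u - v\<bar>"
  obtains C where "0 \<le> C"
    "\<And>u v K. \<bar>u - v\<bar> \<le> 1 / 2 ^ K \<Longrightarrow>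
      \<bar>lacunary \<gamma> \<psi> u - lacunary \<gamma> \<psi> v\<bar> \<le> C * (2 powr - \<gamma>) ^ K"
proof -
  define q \<rho> where "q = (2::real) powr - \<gamma>" and "\<rho> = (2::real) powr - (1 - \<gamma>)"
  have q: "0 < q" "q < 1" and \<rho>: "0 < \<rho>" "\<rho> < 1"
    using two_powr_neg[of \<gamma>] two_powr_neg[of "1 - \<gamma>"] \<gamma> by (auto simp: q_def \<rho>_def)
  \<comment> \<open>Hence a Lipschitz error at scale \<open>2\<^sup>-\<^sup>K\<close> is \<open>q ^ K\<close> times a term of a geometric series.\<close>
  have q\<rho>: "q * \<rho> = 1 / 2"
    unfolding q_def \<rho>_def by (subst powr_add[symmetric]) (simp add: powr_minus_divide)
  define M where "M = 2 * (B / (1 - q))"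
  have M: "\<bar>lacunary \<gamma> \<psi> u - lacunary \<gamma> \<psi> v\<bar> \<le> M" for u v
    using lacunary_bounded[of \<gamma> \<psi> B u] lacunary_bounded[of \<gamma> \<psi> B v] \<gamma> B
    by (simp add: M_def q_def)
  have step: "\<bar>lacunary \<gamma> \<psi> u - lacunary \<gamma> \<psi> v\<bar> \<le> q ^ K * (M + L * (\<Sum>i\<le>K. \<rho> ^ i))"
    if "\<bar>u - v\<bar> \<le> 1 / 2 ^ K" for u v K
    using that
  proof (induction K arbitrary: u v)
    case 0
    show ?case using M[of u v] L by simp
  next
    case (Suc K)
    have "\<bar>2 * u - 2 * v\<bar> = 2 * \<bar>u - v\<bar>" by (simp add: abs_if)
    then have "\<bar>2 * u - 2 * v\<bar> \<le> 1 / 2 ^ K" using Suc.prems by (simp add: field_simps)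
    note IH = Suc.IH[OF this]
    have "\<bar>\<psi> u - \<psi> v\<bar> \<le> L * (1 / 2 ^ Suc K)"
      using L(2)[of u v] mult_left_mono[OF Suc.prems L(1)] by linarith
    also have "1 / 2 ^ Suc K = (q * \<rho>) ^ Suc K" by (simp add: q\<rho> power_divide)
    finally have \<psi>: "\<bar>\<psi> u - \<psi> v\<bar> \<le> q ^ Suc K * (L * \<rho> ^ Suc K)"
      by (simp add: power_mult_distrib mult_ac)
    have "lacunary \<gamma> \<psi> u - lacunary \<gamma> \<psi> v
        = (\<psi> u - \<psi> v) + q * (lacunary \<gamma> \<psi> (2 * u) - lacunary \<gamma> \<psi> (2 * v))"
      using lacunary_rec[OF \<gamma>(1) B, where u=u] lacunary_rec[OF \<gamma>(1) B, where u=v]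
      by (simp add: q_def algebra_simps)
    also have "\<bar>\<dots>\<bar> \<le> \<bar>\<psi> u - \<psi> v\<bar> + q * \<bar>lacunary \<gamma> \<psi> (2 * u) - lacunary \<gamma> \<psi> (2 * v)\<bar>"
      using q by (metis abs_mult abs_of_pos abs_triangle_ineq)
    also have "\<dots> \<le> q ^ Suc K * (L * \<rho> ^ Suc K) + q * (q ^ K * (M + L * (\<Sum>i\<le>K. \<rho> ^ i)))"
      using q by (intro add_mono \<psi> mult_left_mono IH) auto
    also have "\<dots> = q ^ Suc K * (M + L * (\<Sum>i\<le>Suc K. \<rho> ^ i))"
      by (simp add: algebra_simps)
    finally show ?case .
  qed
  show thesis
  proof (rule that[of "\<bar>M\<bar> + L * (1 / (1 - \<rho>))"])
    show "0 \<le> \<bar>M\<bar> + L * (1 / (1 - \<rho>))" using L \<rho> by simp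
    fix u v :: real and K assume "\<bar>u - v\<bar> \<le> 1 / 2 ^ K"
    note step[OF this]
    also have "q ^ K * (M + L * (\<Sum>i\<le>K. \<rho> ^ i)) \<le> q ^ K * (\<bar>M\<bar> + L * (1 / (1 - \<rho>)))"
    proof (intro mult_left_mono add_mono)
      have "(\<Sum>i\<le>K. \<rho> ^ i) \<le> (\<Sum>i. \<rho> ^ i)"
        using \<rho> by (intro sum_le_suminf summable_geometric) auto
      also have "\<dots> = 1 / (1 - \<rho>)" using \<rho> by (intro suminf_geometric) auto
      finally show "(\<Sum>i\<le>K. \<rho> ^ i) \<le> 1 / (1 - \<rho>)" .
    qed (use L q in auto)
    finally show "\<bar>lacunary \<gamma> \<psi> u - lacunary \<gamma> \<psi> v\<bar> \<le> (\<bar>M\<bar> + L * (1 / (1 - \<rho>))) * (2 powr - \<gamma>) ^ K"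
      by (simp add: q_def mult.commute)
  qed
qed

lemma lacunary_holder:
  assumes \<gamma>: "0 < \<gamma>" "\<gamma> < 1" and B: "\<And>u. \<bar>\<psi> u\<bar> \<le> B"
    and L: "0 \<le> L" "\<And>u v. \<bar>\<psi> u - \<psi> v\<bar> \<le> L * \<bar>u - v\<bar>" and "T \<le> 1"
  shows "lacunary \<gamma> \<psi> \<in> holder \<gamma> T"
proof -
  obtain C where C: "0 \<le> C" "\<And>u v K. \<bar>u - v\<bar> \<le> 1 / 2 ^ K \<Longrightarrow>
      \<bar>lacunary \<gamma> \<psi> u - lacunary \<gamma> \<psi> v\<bar> \<le> C * (2 powr - \<gamma>) ^ K"
    using lacunary_increment[OF \<gamma> B L] by metis
  show ?thesis
    by (rule holderI_dyadic[where C=C]) (use assms C in auto)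
qed

lemma lacunary_continuous:
  assumes \<gamma>: "0 < \<gamma>" and B: "\<And>u. \<bar>\<psi> u\<bar> \<le> B" and \<psi>: "continuous_on UNIV \<psi>"
  shows "continuous_on UNIV (lacunary \<gamma> \<psi>)"
proof -
  have "uniform_limit UNIV (\<lambda>n u. \<Sum>j<n. (2 powr - \<gamma>) ^ j * \<psi> (2 ^ j * u)) (lacunary \<gamma> \<psi>) sequentially"
    unfolding lacunary_def
  proof (rule Weierstrass_m_test)
    show "norm ((2 powr - \<gamma>) ^ j * \<psi> (2 ^ j * u)) \<le> (2 powr - \<gamma>) ^ j * B" for j u
      using B by (simp add: abs_mult)
    show "summable (\<lambda>j. (2 powr - \<gamma>) ^ j * B)"
      using two_powr_neg[of \<gamma>] \<gamma> by (intro summable_mult2 summable_geometric) auto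
  qed
  moreover have "continuous_on UNIV (\<lambda>u. \<Sum>j<n. (2 powr - \<gamma>) ^ j * \<psi> (2 ^ j * u))" for n
    by (intro continuous_intros continuous_on_compose2[OF \<psi>]) auto
  ultimately show ?thesis by (intro uniform_limit_theorem) auto
qed

lemma lacunary_dilate: "lacunary \<gamma> (\<lambda>u. \<psi> (c * u)) = (\<lambda>u. lacunary \<gamma> \<psi> (c * u))"
  by (rule ext) (simp add: lacunary_def mult.left_commute)

lemma lacunary_periodic:
  assumes "\<And>u. \<psi> (u + 1) = \<psi> u"
  shows "lacunary \<gamma> \<psi> (u + 1) = lacunary \<gamma> \<psi> u"
proof -
  have "\<psi> (v + real n) = \<psi> v" for v n
  proof (induction n)
    case (Suc n)
    then show ?case using assms[of "v + real n"] by (simp add: add_ac)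
  qed simp
  from this[of "2 ^ j * u" "2 ^ j" for j] show ?thesis
    by (simp add: lacunary_def distrib_left)
qed

section \<open>The Weierstrass series\<close>

definition weierstrass :: "real \<Rightarrow> real \<Rightarrow> real" where
  "weierstrass \<alpha> = lacunary \<alpha> (\<lambda>u. sin (2 * pi * u))"

lemma weierstrass_rec:
  "0 < \<alpha> \<Longrightarrow> weierstrass \<alpha> u = sin (2 * pi * u) + 2 powr - \<alpha> * weierstrass \<alpha> (2 * u)"
  unfolding weierstrass_def by (rule lacunary_rec[where B=1]) auto

lemma weierstrass_periodic: "weierstrass \<alpha> (u + 1) = weierstrass \<alpha> u"
  unfolding weierstrass_def by (rule lacunary_periodic) (simp add: distrib_left)

lemma weierstrass_continuous: "0 < \<alpha> \<Longrightarrow> continuous_on A (weierstrass \<alpha>)"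
  unfolding weierstrass_def
  by (rule continuous_on_subset[OF lacunary_continuous[where B=1]]) (auto intro!: continuous_intros)

lemma abs_sin_diff_le: "\<bar>sin a - sin b\<bar> \<le> \<bar>a - b\<bar>" for a b :: real
proof -
  have "\<bar>sin a - sin b\<bar> = 2 * \<bar>sin ((a - b) / 2)\<bar> * \<bar>cos ((a + b) / 2)\<bar>"
    by (simp add: sin_diff_sin abs_mult)
  also have "\<dots> \<le> 2 * \<bar>(a - b) / 2\<bar> * 1"
    by (intro mult_mono abs_sin_x_le_abs_x) auto
  finally show ?thesis by simp
qed

lemma weierstrass_dilate_holder:
  assumes "0 < \<alpha>" "\<alpha> < 1" "T \<le> 1" "0 < c"
  shows "(\<lambda>u. weierstrass \<alpha> (c * u)) \<in> holder \<alpha> T"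
proof -
  have "\<bar>sin (2 * pi * (c * u)) - sin (2 * pi * (c * v))\<bar> \<le> (2 * pi * c) * \<bar>u - v\<bar>" for u v
  proof -
    have "\<bar>sin (2 * pi * (c * u)) - sin (2 * pi * (c * v))\<bar> \<le> \<bar>2 * pi * (c * u) - 2 * pi * (c * v)\<bar>"
      by (rule abs_sin_diff_le)
    also have "2 * pi * (c * u) - 2 * pi * (c * v) = (2 * pi * c) * (u - v)"
      by (simp add: algebra_simps)
    also have "\<bar>\<dots>\<bar> = (2 * pi * c) * \<bar>u - v\<bar>" using assms by (simp add: abs_mult)
    finally show ?thesis .
  qed
  then have "lacunary \<alpha> (\<lambda>u. sin (2 * pi * (c * u))) \<in> holder \<alpha> T"
    using assms by (intro lacunary_holder[where B=1 and L="2 * pi * c"]) auto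
  then show ?thesis
    using lacunary_dilate[of \<alpha> "\<lambda>u. sin (2 * pi * u)" c]
    by (simp add: weierstrass_def)
qed

lemma height_dilate: "height (\<lambda>u. x (2 ^ p * u)) (p + k) n = height x k n"
proof -
  have "2 ^ p * ((real n + v) / 2 ^ (p + k)) = (real n + v) / 2 ^ k" for v
    by (simp add: power_add)
  then show ?thesis unfolding height_eq_unit_integral by simp
qed

lemma haar_diff_dilate: "haar_diff (\<lambda>u. x (2 ^ p * u)) (p + k) m = haar_diff x k m"
  using height_dilate[of x p "Suc k"] by (simp add: haar_diff_def)

lemma height_shift: "height x k (n + 2 ^ k * c) = height (\<lambda>u. x (u + real c)) k n"
proof -
  have "(real (n + 2 ^ k * c) + v) / 2 ^ k = (real n + v) / 2 ^ k + real c" for v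
    by (simp add: field_simps)
  then show ?thesis unfolding height_eq_unit_integral by simp
qed

lemma height_half_shift: "height x (Suc k) (n + 2 ^ k) = height (\<lambda>u. x (u + 1 / 2)) (Suc k) n"
proof -
  have "(real (n + 2 ^ k) + v) / 2 ^ Suc k = (real n + v) / 2 ^ Suc k + 1 / 2" for v
    by (simp add: field_simps)
  then show ?thesis unfolding height_eq_unit_integral by simp
qed

lemma height_uminus: "height (\<lambda>u. - x u) k n = - height x k n"
  by (simp add: height_def)

lemma height_lincomb:
  assumes "continuous_on UNIV f" "continuous_on UNIV g"
  shows "height (\<lambda>u. f u + c * g u) k n = height f k n + c * height g k n"
proof -
  have "f integrable_on dyadic_interval k n" "g integrable_on dyadic_interval k n"
    using assms unfolding dyadic_interval_def
    by (auto intro!: integrable_continuous_real intro: continuous_on_subset)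
  then have "((\<lambda>u. f u + c * g u) has_integral
      integral (dyadic_interval k n) f + c * integral (dyadic_interval k n) g) (dyadic_interval k n)"
    by (intro has_integral_add has_integral_mult_right integrable_integral)
  then show ?thesis
    by (simp add: height_def integral_unique algebra_simps)
qed

lemma sum_lessThan_double:
  fixes g :: "nat \<Rightarrow> real"
  shows "(\<Sum>m<2 ^ Suc k. g m) = (\<Sum>m<2 ^ k. g m) + (\<Sum>m<2 ^ k. g (m + 2 ^ k))"
proof -
  have "(\<Sum>m<a + b. g m) = (\<Sum>m<a. g m) + (\<Sum>m<b. g (m + a))" for a b
    by (induction b) (auto simp: add_ac)
  from this[of "2 ^ k" "2 ^ k"] show ?thesis by (simp add: mult_2)
qed

text \<open>
  At every level but the coarsest, each cell lies in one half of the period of the sine, and the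
  two halves contribute opposite amounts.
\<close>

lemma haar_sum_sine:
  "(\<Sum>m<2 ^ Suc k. haar_diff (\<lambda>u. sin (2 * pi * u)) (Suc k) m) = 0"
proof -
  let ?s = "\<lambda>u. sin (2 * pi * u) :: real"
  have "?s (u + 1 / 2) = - ?s u" for u by (simp add: distrib_left)
  then have half: "height ?s (Suc (Suc k)) (n + 2 ^ Suc k) = - height ?s (Suc (Suc k)) n" for n
    unfolding height_half_shift by (simp add: height_uminus)
  have neg: "haar_diff ?s (Suc k) (m + 2 ^ k) = - haar_diff ?s (Suc k) m" for m
    using half[of "2 * m"] half[of "2 * m + 1"] by (simp add: haar_diff_def distrib_left)
  have "(\<Sum>m<2 ^ Suc k. haar_diff ?s (Suc k) m)
      = (\<Sum>m<2 ^ k. haar_diff ?s (Suc k) m) + (\<Sum>m<2 ^ k. haar_diff ?s (Suc k) (m + 2 ^ k))"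
    by (rule sum_lessThan_double)
  then show ?thesis by (simp add: neg sum_negf)
qed

lemma haar_sine: "haar_diff (\<lambda>u. sin (2 * pi * u)) 0 0 = - 4 / pi"
proof -
  define F :: "real \<Rightarrow> real" where "F u = - cos (2 * pi * u) / (2 * pi)" for u
  have "((\<lambda>u. sin (2 * pi * u)) has_integral F b - F a) {a..b}" if "a \<le> b" for a b :: real
    using that
    by (intro fundamental_theorem_of_calculus)
      (auto simp: F_def has_real_derivative_iff_has_vector_derivative[symmetric]
        intro!: derivative_eq_intros)
  then have int: "integral {a..b} (\<lambda>u. sin (2 * pi * u)) = F b - F a" if "a \<le> b" for a b
    using that by (simp add: integral_unique)
  have "integral {0..1 / 2} (\<lambda>u. sin (2 * pi * u)) = 1 / pi"
    "integral {1 / 2..1} (\<lambda>u. sin (2 * pi * u)) = - 1 / pi"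
    by (simp_all add: int F_def)
  then show ?thesis
    by (simp add: haar_diff_def height_def dyadic_interval_def dyadic_def)
qed

text \<open>
  By the functional equation the sum of the Haar differences of the series over one period is,
  at level \<open>k + 1\<close>, the corresponding sum for the sine, which vanishes, plus twice the scaled sum
  at level \<open>k\<close>.
\<close>

lemma haar_sum_weierstrass:
  assumes "0 < \<alpha>"
  shows "(\<Sum>m<2 ^ k. haar_diff (weierstrass \<alpha>) k m) = - 4 / pi * (2 * 2 powr - \<alpha>) ^ k"
proof -
  let ?W = "weierstrass \<alpha>" and ?s = "\<lambda>u. sin (2 * pi * u) :: real"
  have split: "height ?W k n = height ?s k n + 2 powr - \<alpha> * height (\<lambda>u. ?W (2 * u)) k n" for k n
  proof -
    have "height ?W k n = height (\<lambda>u. ?s u + 2 powr - \<alpha> * ?W (2 * u)) k n"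
      by (intro arg_cong[where f="\<lambda>x. height x k n"] ext weierstrass_rec assms)
    also have "\<dots> = height ?s k n + 2 powr - \<alpha> * height (\<lambda>u. ?W (2 * u)) k n"
      by (intro height_lincomb continuous_intros
          continuous_on_compose2[OF weierstrass_continuous[OF assms, of UNIV]]) auto
    finally show ?thesis .
  qed
  have haar_split: "haar_diff ?W k m = haar_diff ?s k m + 2 powr - \<alpha> * haar_diff (\<lambda>u. ?W (2 * u)) k m"
    for k m
    by (simp add: haar_diff_def split algebra_simps)
  have double: "haar_diff (\<lambda>u. ?W (2 * u)) (Suc k) m = haar_diff ?W k m" for k m
    using haar_diff_dilate[of ?W 1 k m] by simp
  have periodic: "height ?W k (n + 2 ^ k) = height ?W k n" for k n
    using height_shift[of ?W k n 1] by (simp add: weierstrass_periodic)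
  have haar_periodic: "haar_diff ?W k (m + 2 ^ k) = haar_diff ?W k m" for k m
    using periodic[of "Suc k" "2 * m"] periodic[of "Suc k" "2 * m + 1"]
    by (simp add: haar_diff_def distrib_left)
  show ?thesis
  proof (induction k)
    case 0
    have "haar_diff (\<lambda>u. ?W (2 * u)) 0 0 = 0"
      using height_dilate[of ?W 1 0 0] height_dilate[of ?W 1 0 1] periodic[of 0 0]
      by (simp add: haar_diff_def)
    then show ?case using haar_split[of 0 0] haar_sine by simp
  next
    case (Suc k)
    have "(\<Sum>m<2 ^ Suc k. haar_diff ?W (Suc k) m)
        = 2 powr - \<alpha> * (\<Sum>m<2 ^ Suc k. haar_diff ?W k m)"
      using haar_sum_sine[of k]
      by (simp add: haar_split[of "Suc k"] double sum.distrib sum_distrib_left)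
    also have "(\<Sum>m<2 ^ Suc k. haar_diff ?W k m)
        = (\<Sum>m<2 ^ k. haar_diff ?W k m) + (\<Sum>m<2 ^ k. haar_diff ?W k (m + 2 ^ k))"
      by (rule sum_lessThan_double)
    finally show ?case by (simp add: haar_periodic Suc.IH)
  qed
qed

section \<open>The Takagi series\<close>

definition takagi :: "real \<Rightarrow> real \<Rightarrow> real" where
  "takagi \<beta> = lacunary \<beta> (\<lambda>u. infdist u \<int>)"

lemma infdist_Ints_lipschitz: "\<bar>infdist u \<int> - infdist v \<int>\<bar> \<le> \<bar>u - v\<bar>" for u v :: real
  using infdist_triangle[of u \<int> v] infdist_triangle[of v \<int> u]
  by (simp add: dist_real_def abs_minus_commute)

lemma Ints_nonempty: "(\<int> :: real set) \<noteq> {}"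
  using Ints_0 by blast

lemma infdist_Ints_eq:
  fixes u :: real
  shows "of_int n \<le> u \<Longrightarrow> u \<le> of_int n + 1 / 2 \<Longrightarrow> infdist u \<int> = u - of_int n"
    "of_int n + 1 / 2 \<le> u \<Longrightarrow> u \<le> of_int n + 1 \<Longrightarrow> infdist u \<int> = of_int n + 1 - u"
proof -
  have lower: "min (u - of_int n) (of_int n + 1 - u) \<le> infdist u \<int>"
    if "of_int n \<le> u" "u \<le> of_int n + 1"
    unfolding infdist_notempty[OF Ints_nonempty]
  proof (rule cINF_greatest)
    fix z :: real assume "z \<in> \<int>"
    then obtain i where i: "z = of_int i" by (auto elim: Ints_cases)
    have "i \<le> n \<or> n + 1 \<le> i" by linarith
    then have "z \<le> of_int n \<or> of_int n + 1 \<le> z" unfolding i by linarith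
    then show "min (u - of_int n) (of_int n + 1 - u) \<le> dist u z"
      by (auto simp: dist_real_def)
  qed (rule Ints_nonempty)
  have upper: "infdist u \<int> \<le> \<bar>u - of_int i\<bar>" for i
    using infdist_le[of "of_int i" \<int> u] by (simp add: dist_real_def)
  show "infdist u \<int> = u - of_int n" if "of_int n \<le> u" "u \<le> of_int n + 1 / 2"
    using lower upper[of n] that by simp
  show "infdist u \<int> = of_int n + 1 - u" if "of_int n + 1 / 2 \<le> u" "u \<le> of_int n + 1"
    using lower upper[of "n + 1"] that by simp
qed

lemma infdist_Ints_le: "\<bar>infdist u \<int>\<bar> \<le> 1" for u :: real
  using infdist_le[of "of_int \<lfloor>u\<rfloor>" \<int> u] by (simp add: infdist_nonneg dist_real_def) linarith

lemma takagi_rec: "0 < \<beta> \<Longrightarrow> takagi \<beta> u = infdist u \<int> + 2 powr - \<beta> * takagi \<beta> (2 * u)"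
  unfolding takagi_def by (rule lacunary_rec[OF _ infdist_Ints_le])

lemma takagi_nat: "takagi \<beta> (real n) = 0"
proof -
  have "2 ^ j * real n \<in> \<int>" for j by simp
  then show ?thesis by (simp add: takagi_def lacunary_def)
qed

lemma takagi_dilate_holder:
  assumes "0 < \<beta>" "\<beta> < 1" "T \<le> 1" "0 < c"
  shows "(\<lambda>u. takagi \<beta> (c * u)) \<in> holder \<beta> T"
proof -
  have "\<bar>infdist (c * u) \<int> - infdist (c * v) \<int>\<bar> \<le> c * \<bar>u - v\<bar>" for u v
    using infdist_Ints_lipschitz[of "c * u" "c * v"] assms
    by (simp add: right_diff_distrib[symmetric] abs_mult)
  then have "lacunary \<beta> (\<lambda>u. infdist (c * u) \<int>) \<in> holder \<beta> T"
    using assms infdist_Ints_le by (intro lacunary_holder[where B=1 and L=c]) auto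
  then show ?thesis
    using lacunary_dilate[of \<beta> "\<lambda>u. infdist u \<int>" c]
    by (simp add: takagi_def)
qed

text \<open>
  The distance to the integers is affine on dyadic intervals of length at most one half, so that
  only the coarsest level has a defect.
\<close>

lemma midpoint_defect_infdist:
  "midpoint_defect (\<lambda>u. infdist u \<int>) k m = (if k = 0 then 1 / 2 else 0)"
proof (cases k)
  case 0
  have "infdist (dyadic 1 (2 * m + 1)) \<int> = 1 / 2"
    using infdist_Ints_eq(1)[of "int m" "dyadic 1 (2 * m + 1)"] by (simp add: dyadic_def field_simps)
  moreover have "dyadic 0 n \<in> \<int>" for n by (simp add: dyadic_def)
  ultimately show ?thesis using 0 by (simp add: midpoint_defect_def)
next
  case (Suc j)
  define a b c where "a = dyadic k m" and "b = dyadic k (Suc m)" and "c = dyadic (Suc k) (2 * m + 1)"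
  have c: "c = (a + b) / 2" and ab: "a \<le> b"
    by (simp_all add: a_def b_def c_def dyadic_def field_simps)
  \<comment> \<open>The cell \<open>[a,b]\<close> lies in the interval of length one half with index \<open>i\<close>.\<close>
  define i where "i = m div 2 ^ j"
  have "real i / 2 \<le> a" "b \<le> real (Suc i) / 2"
  proof -
    have "i * 2 ^ j \<le> m" by (simp add: i_def)
    then have "real (i * 2 ^ j) \<le> real m" by (simp only: of_nat_le_iff)
    then show "real i / 2 \<le> a" by (simp add: a_def dyadic_def Suc field_simps)
    have "Suc m \<le> Suc i * 2 ^ j"
      using dividend_less_div_times[of "2 ^ j" m] by (simp add: i_def)
    then have "real (Suc m) \<le> real (Suc i * 2 ^ j)" by (simp only: of_nat_le_iff)
    then show "b \<le> real (Suc i) / 2" by (simp add: b_def dyadic_def Suc field_simps)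
  qed
  moreover obtain n where "i = 2 * n \<or> i = 2 * n + 1" by (metis oddE evenE)
  ultimately consider "real n \<le> a" "b \<le> real n + 1 / 2" | "real n + 1 / 2 \<le> a" "b \<le> real n + 1"
    by fastforce
  then have "infdist c \<int> = (infdist a \<int> + infdist b \<int>) / 2"
  proof cases
    case 1
    then have "infdist a \<int> = a - n" "infdist b \<int> = b - n" "infdist c \<int> = c - n"
      using infdist_Ints_eq(1)[of "int n"] ab c by simp_all
    then show ?thesis unfolding c by (simp add: field_simps)
  next
    case 2
    then have "infdist a \<int> = n + 1 - a" "infdist b \<int> = n + 1 - b" "infdist c \<int> = n + 1 - c"
      using infdist_Ints_eq(2)[of "int n"] ab c by simp_all
    then show ?thesis unfolding c by (simp add: field_simps)
  qed
  then show ?thesis using Suc by (simp add: midpoint_defect_def a_def b_def c_def)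
qed

text \<open>
  The functional equation carries the defect from one level to the next with the factor \<open>2\<close> to the
  power \<open>-\<beta>\<close>; it starts from \<open>1/2\<close> because the series vanishes at the integers.
\<close>

lemma midpoint_defect_takagi:
  assumes "0 < \<beta>"
  shows "midpoint_defect (takagi \<beta>) k m = (2 powr - \<beta>) ^ k / 2"
proof (induction k)
  case 0
  have "2 * dyadic 1 (2 * m + 1) = real (2 * m + 1)" by (simp add: dyadic_def)
  then have "takagi \<beta> (dyadic 1 (2 * m + 1)) = infdist (dyadic 1 (2 * m + 1)) \<int>"
    using takagi_rec[OF assms, of "dyadic 1 (2 * m + 1)"] takagi_nat[of \<beta> "2 * m + 1"]
    by simp
  moreover have "takagi \<beta> (dyadic 0 n) = infdist (dyadic 0 n) \<int>" for n
    using takagi_nat[of \<beta> n] by (simp add: dyadic_def)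
  ultimately show ?case
    using midpoint_defect_infdist[of 0 m] by (simp add: midpoint_defect_def)
next
  case (Suc k)
  have rec: "takagi \<beta> (dyadic (Suc i) n)
      = infdist (dyadic (Suc i) n) \<int> + 2 powr - \<beta> * takagi \<beta> (dyadic i n)" for i n
    using takagi_rec[OF assms, of "dyadic (Suc i) n"] by (simp add: dyadic_def)
  have "midpoint_defect (takagi \<beta>) (Suc k) m
      = midpoint_defect (\<lambda>u. infdist u \<int>) (Suc k) m + 2 powr - \<beta> * midpoint_defect (takagi \<beta>) k m"
    unfolding midpoint_defect_def
    using rec[of "Suc k" "2 * m + 1"] rec[of k m] rec[of k "m + 1"]
    by (simp add: algebra_simps add_divide_distrib)
  then show ?case by (simp add: Suc.IH midpoint_defect_infdist)
qed

section \<open>Exponents with sum at most one\<close>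

lemma midpoint_defect_dilate:
  "midpoint_defect (\<lambda>u. y (2 ^ p * u)) (p + k) m = midpoint_defect y k m"
proof -
  have "2 ^ p * dyadic (p + k) n = dyadic k n" for k n
    by (simp add: dyadic_def power_add)
  from this[of k] this[of "Suc k"] show ?thesis by (simp add: midpoint_defect_def)
qed

lemma cells_upto_dyadic: "cells_upto (p + k) (1 / 2 ^ p) = 2 ^ k"
proof -
  have "2 ^ (p + k) * (1 / 2 ^ p) = real (2 ^ k)" by (simp add: power_add)
  then show ?thesis unfolding cells_upto_def by (simp only: floor_of_nat nat_int)
qed

lemma decay_product_ge_1:
  assumes "\<alpha> + \<beta> \<le> 1"
  shows "1 \<le> 2 * ((2::real) powr - \<alpha> * 2 powr - \<beta>)"
  unfolding decay_product using assms by (intro ge_one_powr_ge_zero) auto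

text \<open>
  For the Weierstrass and the Takagi series the change of the Riemann sum from one level to the
  next is, up to the sign, the common value of the midpoint defects times the sum of the Haar
  differences over a period, and so it does not tend to zero.  The boundary terms of the summation by
  parts vanish because the Takagi series is zero at the integers.
\<close>

lemma not_dyadic_integrable:
  assumes "0 < \<alpha>" "0 < \<beta>" "\<alpha> + \<beta> \<le> 1"
  shows "\<not> dyadic_integrable (\<lambda>u. weierstrass \<alpha> (2 ^ p * u)) (\<lambda>u. takagi \<beta> (2 ^ p * u)) 0 (1 / 2 ^ p)"
proof
  define x where "x = (\<lambda>u. weierstrass \<alpha> (2 ^ p * u))"
  define y where "y = (\<lambda>u. takagi \<beta> (2 ^ p * u))"
  define S where "S = approx_sum x y 0 (1 / 2 ^ p)"
  assume "dyadic_integrable (\<lambda>u. weierstrass \<alpha> (2 ^ p * u)) (\<lambda>u. takagi \<beta> (2 ^ p * u)) 0 (1 / 2 ^ p)"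
  then have "convergent S" by (simp add: S_def x_def y_def dyadic_integrable_def)
  then obtain l where l: "S \<longlonglongrightarrow> l" by (auto simp: convergent_def)
  have ends: "y 0 = 0" "y (dyadic (p + k) (2 ^ k)) = 0" for k
    using takagi_nat[of \<beta> 0] takagi_nat[of \<beta> 1] by (simp_all add: y_def dyadic_def power_add)
  have S: "S (Suc (p + k)) = - riemann_sum x y (Suc (p + k)) (2 * 2 ^ k)" for k
    using approx_sum_eq[where t="1 / 2 ^ p" and x=x and y=y and k="p + k"] ends(1) ends(2)[of k]
    by (simp add: S_def cells_upto_dyadic)
  have cont: "continuous_on A x" for A
    unfolding x_def
    by (rule continuous_on_compose2[OF weierstrass_continuous[OF assms(1), of UNIV]])
      (auto intro!: continuous_intros)
  have jump: "S (Suc (Suc (p + k))) - S (Suc (p + k))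
      = - 2 / pi * (2 * (2 powr - \<alpha> * 2 powr - \<beta>)) ^ Suc k" for k
  proof -
    have "riemann_sum x y (Suc (p + Suc k)) (2 * 2 ^ Suc k) = riemann_sum x y (p + Suc k) (2 ^ Suc k)
        - (\<Sum>m<2 ^ Suc k. haar_diff x (p + Suc k) m * midpoint_defect y (p + Suc k) m)"
      by (rule riemann_sum_refine[OF cont])
    also have "(\<Sum>m<2 ^ Suc k. haar_diff x (p + Suc k) m * midpoint_defect y (p + Suc k) m)
        = (\<Sum>m<2 ^ Suc k. haar_diff (weierstrass \<alpha>) (Suc k) m) * ((2 powr - \<beta>) ^ Suc k / 2)"
      unfolding x_def y_def haar_diff_dilate midpoint_defect_dilate
      by (simp only: midpoint_defect_takagi[OF assms(2)] sum_distrib_right)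
    also have "\<dots> = - 2 / pi * (2 * (2 powr - \<alpha> * 2 powr - \<beta>)) ^ Suc k"
      unfolding haar_sum_weierstrass[OF assms(1)] by (simp add: power_mult_distrib)
    finally show ?thesis using S[of k] S[of "Suc k"] by simp
  qed
  have "(\<lambda>k. S (Suc (Suc (p + k))) - S (Suc (p + k))) \<longlonglongrightarrow> l - l"
    using LIMSEQ_ignore_initial_segment[OF l, of "Suc (Suc p)"]
      LIMSEQ_ignore_initial_segment[OF l, of "Suc p"]
    by (intro tendsto_diff) (simp_all add: add.commute)
  then have "(\<lambda>k. \<bar>S (Suc (Suc (p + k))) - S (Suc (p + k))\<bar>) \<longlonglongrightarrow> 0"
    by (simp add: tendsto_rabs_zero)
  moreover have "2 / pi \<le> \<bar>S (Suc (Suc (p + k))) - S (Suc (p + k))\<bar>" for k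
  proof -
    have "1 \<le> (2 * (2 powr - \<alpha> * 2 powr - \<beta>)) ^ Suc k"
      by (intro one_le_power decay_product_ge_1 assms)
    then have "2 / pi * 1 \<le> 2 / pi * (2 * (2 powr - \<alpha> * 2 powr - \<beta>)) ^ Suc k"
      by (intro mult_left_mono) auto
    then show ?thesis unfolding jump abs_mult by (simp add: abs_mult)
  qed
  ultimately have "2 / pi \<le> 0" by (intro LIMSEQ_le_const) auto
  then show False using pi_gt_zero by (simp add: divide_le_0_iff)
qed

text \<open>
  The absolute sum of the Haar differences dominates the modulus of their sum, which bounds the terms
  of the series from below by a positive constant.
\<close>

lemma area_series_diverges:
  assumes "0 < \<alpha>" "\<alpha> + \<beta> \<le> 1"
  shows "\<not> (\<lambda>k. 2 powr (real k * (1 - \<beta>)) *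
    area (\<lambda>u. weierstrass \<alpha> (2 ^ p * u)) 0 (1 / 2 ^ p) (k - 1)) summable_on {p + 1..}"
proof
  define x where "x = (\<lambda>u. weierstrass \<alpha> (2 ^ p * u))"
  define f where "f k = 2 powr (real k * (1 - \<beta>)) * area x 0 (1 / 2 ^ p) (k - 1)" for k
  define q where "q = (2::real) powr - \<beta>"
  have "0 < q" by (simp add: q_def)
  assume "(\<lambda>k. 2 powr (real k * (1 - \<beta>)) *
    area (\<lambda>u. weierstrass \<alpha> (2 ^ p * u)) 0 (1 / 2 ^ p) (k - 1)) summable_on {p + 1..}"
  then have "f summable_on {p + 1..}" by (simp add: f_def[abs_def] x_def)
  also have "{p + 1..} = (\<lambda>k. Suc (p + k)) ` UNIV"
    by (auto simp: image_iff) (metis add_Suc le_Suc_ex)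
  finally have "(f \<circ> (\<lambda>k. Suc (p + k))) summable_on UNIV"
    by (subst (asm) summable_on_reindex) (auto simp: inj_on_def)
  then have "(\<lambda>k. f (Suc (p + k))) \<longlonglongrightarrow> 0"
    using summable_LIMSEQ_zero[OF summable_on_imp_summable] by (simp add: o_def)
  moreover have "q ^ Suc p * (4 / pi) \<le> f (Suc (p + k))" for k
  proof -
    have "{n. dyadic_interval (p + k) n \<subseteq> {0..1 / 2 ^ p}} = {..<2 ^ k}"
      by (auto simp: dyadic_interval_subset_iff le_cells_upto_iff[symmetric] cells_upto_dyadic)
    then have area: "area x 0 (1 / 2 ^ p) (p + k)
        = 1 / 2 ^ Suc (p + k) * (\<Sum>m<2 ^ k. \<bar>haar_diff x (p + k) m\<bar>)"
      by (simp add: area_def haar_diff_def)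
    have "4 / pi * (2 * 2 powr - \<alpha>) ^ k = \<bar>\<Sum>m<2 ^ k. haar_diff x (p + k) m\<bar>"
      unfolding x_def haar_diff_dilate haar_sum_weierstrass[OF assms(1)] by (simp add: abs_mult)
    also have "\<dots> \<le> (\<Sum>m<2 ^ k. \<bar>haar_diff x (p + k) m\<bar>)" by (rule sum_abs)
    finally have "1 / 2 ^ Suc (p + k) * (4 / pi * (2 * 2 powr - \<alpha>) ^ k) \<le> area x 0 (1 / 2 ^ p) (p + k)"
      unfolding area by (rule mult_left_mono) simp
    moreover have "2 powr (real (Suc (p + k)) * (1 - \<beta>)) = (2 * q) ^ Suc (p + k)"
    proof -
      have "2 * q = 2 powr (1 - \<beta>)" by (simp add: q_def powr_diff powr_minus field_simps)
      then show ?thesis by (subst \<open>2 * q = _\<close>, subst powr_power) auto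
    qed
    ultimately have "(2 * q) ^ Suc (p + k) * (1 / 2 ^ Suc (p + k) * (4 / pi * (2 * 2 powr - \<alpha>) ^ k))
        \<le> f (Suc (p + k))"
      unfolding f_def using \<open>0 < q\<close> by (simp only:) (intro mult_left_mono, auto)
    moreover have "(2 * q) ^ Suc (p + k) * (1 / 2 ^ Suc (p + k) * (4 / pi * (2 * 2 powr - \<alpha>) ^ k))
        = q ^ Suc p * (4 / pi) * (2 * (2 powr - \<alpha> * q)) ^ k"
      by (simp add: power_mult_distrib power_add)
    moreover have "q ^ Suc p * (4 / pi) * 1 \<le> q ^ Suc p * (4 / pi) * (2 * (2 powr - \<alpha> * q)) ^ k"
      using decay_product_ge_1[OF assms(2)] \<open>0 < q\<close>
      by (intro mult_left_mono one_le_power) (auto simp: q_def)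
    ultimately show ?thesis by linarith
  qed
  ultimately have "q ^ Suc p * (4 / pi) \<le> 0" by (intro LIMSEQ_le_const) auto
  moreover have "0 < q ^ Suc p * (4 / pi)" using \<open>0 < q\<close> by simp
  ultimately show False by linarith
qed

lemma obtain_dyadic_period:
  fixes T :: real
  assumes "0 < T"
  obtains p where "1 < p" "1 / 2 ^ p \<le> T"
proof -
  obtain n :: nat where n: "(1/2) ^ n < T"
    using real_arch_pow_inv[of T "1/2"] assms by auto
  have "(1/2::real) ^ (n + 2) \<le> (1/2) ^ n" by (intro power_decreasing) auto
  with n have "1 / 2 ^ (n + 2) \<le> T" by (simp add: power_divide)
  then show thesis by (rule that[rotated]) simp
qed

lemma sum_gt_1_of_T_maps:
  assumes "0 < \<alpha>" "0 < \<beta>" "0 < T" "T \<le> 1"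
    and T: "\<And>x. x \<in> holder \<alpha> T \<Longrightarrow> T_op_maps_holder \<beta> T y0 x"
  shows "1 < \<alpha> + \<beta>"
proof (rule ccontr)
  assume "\<not> 1 < \<alpha> + \<beta>"
  then have le: "\<alpha> + \<beta> \<le> 1" by simp
  obtain p where p: "1 / 2 ^ p \<le> T" using obtain_dyadic_period[OF \<open>0 < T\<close>] .
  have "(\<lambda>u. weierstrass \<alpha> (2 ^ p * u)) \<in> holder \<alpha> T" "(\<lambda>u. takagi \<beta> (2 ^ p * u)) \<in> holder \<beta> T"
    using assms le by (auto intro!: weierstrass_dilate_holder takagi_dilate_holder)
  with T p have "dyadic_integrable (\<lambda>u. weierstrass \<alpha> (2 ^ p * u)) (\<lambda>u. takagi \<beta> (2 ^ p * u)) 0 (1 / 2 ^ p)"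
    unfolding T_op_maps_holder_def by auto
  with not_dyadic_integrable[OF assms(1,2) le] show False by blast
qed

lemma sum_gt_1_of_area_series:
  assumes "0 < \<alpha>" "0 < \<beta>" "0 < T" "T \<le> 1"
    and area: "\<And>x a b k0. x \<in> holder \<alpha> T \<Longrightarrow> 0 \<le> a \<Longrightarrow> a < b \<Longrightarrow> b \<le> T \<Longrightarrow> 1 < k0 \<Longrightarrow>
      2 powr (- real k0 - 1) \<le> b - a \<Longrightarrow> b - a \<le> 2 powr (- real k0 + 1) \<Longrightarrow>
      (\<lambda>k. 2 powr (real k * (1 - \<beta>)) * area x a b (k - 1)) summable_on {k0 + 1..}"
  shows "1 < \<alpha> + \<beta>"
proof (rule ccontr)
  assume "\<not> 1 < \<alpha> + \<beta>"
  then have le: "\<alpha> + \<beta> \<le> 1" by simp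
  obtain p where p: "1 < p" "1 / 2 ^ p \<le> T" using obtain_dyadic_period[OF \<open>0 < T\<close>] .
  have "(\<lambda>u. weierstrass \<alpha> (2 ^ p * u)) \<in> holder \<alpha> T"
    using assms le by (auto intro!: weierstrass_dilate_holder)
  moreover have "1 / 2 ^ p = (2::real) powr - real p"
    by (simp add: powr_minus_divide powr_realpow)
  ultimately have "(\<lambda>k. 2 powr (real k * (1 - \<beta>)) *
      area (\<lambda>u. weierstrass \<alpha> (2 ^ p * u)) 0 (1 / 2 ^ p) (k - 1)) summable_on {p + 1..}"
    using p by (intro area) auto
  with area_series_diverges[OF assms(1) le] show False by blast
qed

theorem theorem2p4:
  fixes \<alpha> \<beta> T y0 :: real
  assumes "0 < \<alpha>" "\<alpha> \<le> 1" and "0 < \<beta>" "\<beta> \<le> 1" and "0 < T" "T \<le> 1"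
  shows "(\<forall>x \<in> holder \<alpha> T. T_op_maps_holder \<beta> T y0 x) \<longleftrightarrow>
    (\<alpha> \<ge> \<beta> \<and>
     (\<forall>x \<in> holder \<alpha> T. \<exists>C::real. \<forall>(a::real) (b::real) (k0::nat).
        0 \<le> a \<and> a < b \<and> b \<le> T \<and> k0 > 1 \<and>
        2 powr (- real k0 - 1) \<le> b - a \<and> b - a \<le> 2 powr (- real k0 + 1) \<longrightarrow>
        (\<lambda>k. 2 powr (real k * (1 - \<beta>)) * area x a b (k - 1)) summable_on {k0 + 1..} \<and>
        (\<Sum>\<^sub>\<infinity>k\<in>{k0 + 1..}. 2 powr (real k * (1 - \<beta>)) * area x a b (k - 1))
          \<le> C * 2 powr (- \<beta> * real k0)))"
    (is "?maps \<longleftrightarrow> \<alpha> \<ge> \<beta> \<and> ?area")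
proof
  assume maps: ?maps
  have "\<alpha> \<ge> \<beta>" by (rule exponent_le_of_T_maps[OF assms(1-3,5,6)]) (use maps in blast)
  moreover have "1 < \<alpha> + \<beta>" by (rule sum_gt_1_of_T_maps[OF assms(1,3,5,6)]) (use maps in blast)
  then have ?area
    using assms by (intro ballI area_series_bound) auto
  ultimately show "\<alpha> \<ge> \<beta> \<and> ?area" ..
next
  assume rhs: "\<alpha> \<ge> \<beta> \<and> ?area"
  have "1 < \<alpha> + \<beta>"
  proof (rule sum_gt_1_of_area_series)
    fix x a b and k0 :: nat
    assume "x \<in> holder \<alpha> T"
    with rhs obtain C where C: "\<forall>(a::real) (b::real) (k0::nat).
        0 \<le> a \<and> a < b \<and> b \<le> T \<and> k0 > 1 \<and>
        2 powr (- real k0 - 1) \<le> b - a \<and> b - a \<le> 2 powr (- real k0 + 1) \<longrightarrow>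
        (\<lambda>k. 2 powr (real k * (1 - \<beta>)) * area x a b (k - 1)) summable_on {k0 + 1..} \<and>
        (\<Sum>\<^sub>\<infinity>k\<in>{k0 + 1..}. 2 powr (real k * (1 - \<beta>)) * area x a b (k - 1))
          \<le> C * 2 powr (- \<beta> * real k0)"
      by blast
    assume "0 \<le> a" "a < b" "b \<le> T" "1 < k0"
      "2 powr (- real k0 - 1) \<le> b - a" "b - a \<le> 2 powr (- real k0 + 1)"
    with C show "(\<lambda>k. 2 powr (real k * (1 - \<beta>)) * area x a b (k - 1)) summable_on {k0 + 1..}"
      by blast
  qed (use assms in auto)
  with rhs assms show ?maps by (auto intro: T_maps_holder)
qed

end
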